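(* Let $\Delta_n$ denote the maximum degree of a graph drawn uniformly at random from the graphs in $\mathrm{Ex}(C_5)$ with $n$ vertices. Then for every $\epsilon>0$, $$\Delta_n \le (1+\epsilon)\frac{\log n}{\log\log\log n}\qquad\text{w.h.p.}$$
   Context: All graphs are labelled. $\mathrm{Ex}(C_5)$ is the class of labelled graphs not containing the 5-cycle $C_5$ as a minor; a random graph of size $n$ is drawn uniformly from the graphs in the class on vertex set $\{1,\dots,n\}$. An event holds with high probability (w.h.p.) if its probability tends to $1$ as $n\to\infty$. $\log$ is the natural logarithm. *)

theory Defs
  imports "HOL-Probability.Probability"
begin

type_synonym 'a ugraph = "'a set \<times> 'a set set"

abbreviation gverts :: "'a ugraph \<Rightarrow> 'a set" where "gverts G \<equiv> fst G"
abbreviation gedges :: "'a ugraph \<Rightarrow> 'a set set" where "gedges G \<equiv> snd G"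

definition simple_graph :: "'a ugraph \<Rightarrow> bool" where
  "simple_graph G \<longleftrightarrow> finite (gverts G) \<and> (\<forall>e\<in>gedges G. e \<subseteq> gverts G \<and> card e = 2)"

definition connected_in :: "'a ugraph \<Rightarrow> 'a set \<Rightarrow> bool" where
  "connected_in G S \<longleftrightarrow> S \<noteq> {} \<and> S \<subseteq> gverts G \<and>
     (\<forall>u\<in>S. \<forall>v\<in>S. (u, v) \<in> {(x, y). x \<in> S \<and> y \<in> S \<and> {x, y} \<in> gedges G}\<^sup>*)"

text \<open>
  \<open>B\<close> is a minor model: contracting each connected branch set \<open>B x\<close> to a single vertex and
  deleting superfluous vertices and edges turns \<open>G\<close> into \<open>H\<close>.
\<close>
definition is_minor :: "'b ugraph \<Rightarrow> 'a ugraph \<Rightarrow> bool" where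
  "is_minor H G \<longleftrightarrow> (\<exists>B. disjoint_family_on B (gverts H) \<and>
     (\<forall>x\<in>gverts H. connected_in G (B x)) \<and>
     (\<forall>x\<in>gverts H. \<forall>y\<in>gverts H. {x, y} \<in> gedges H \<longrightarrow>
        (\<exists>u\<in>B x. \<exists>v\<in>B y. {u, v} \<in> gedges G)))"

text \<open>A cycle only for \<open>k \<ge> 3\<close>.\<close>
definition cycle_graph :: "nat \<Rightarrow> nat ugraph" where
  "cycle_graph k = ({..<k}, {{i, (i + 1) mod k} |i. i < k})"

definition Ex_minor :: "'b ugraph \<Rightarrow> nat ugraph set" where
  "Ex_minor H = {G. simple_graph G \<and> \<not> is_minor H G}"

definition graphs_of_size :: "nat ugraph set \<Rightarrow> nat \<Rightarrow> nat ugraph set" where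
  "graphs_of_size \<G> n = {G \<in> \<G>. gverts G = {1..n}}"

definition random_graph :: "nat ugraph set \<Rightarrow> nat \<Rightarrow> nat ugraph pmf" where
  "random_graph \<G> n = pmf_of_set (graphs_of_size \<G> n)"

definition gdegree :: "'a ugraph \<Rightarrow> 'a \<Rightarrow> nat" where
  "gdegree G v = card {e \<in> gedges G. v \<in> e}"

text \<open>Unspecified for the graph without vertices.\<close>
definition max_degree :: "'a ugraph \<Rightarrow> nat" where
  "max_degree G = Max (gdegree G ` gverts G)"

lemma finite_graphs_of_size_Ex: "finite (graphs_of_size (Ex_minor H) n)"
proof (rule finite_subset)
  show "graphs_of_size (Ex_minor H) n \<subseteq> {{1..n}} \<times> Pow (Pow {1..n})"
    by (force simp: graphs_of_size_def Ex_minor_def simple_graph_def)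
qed auto

lemma edgeless_not_minor_cycle5: "\<not> is_minor (cycle_graph 5) (V, {})"
proof
  assume "is_minor (cycle_graph 5) (V, {})"
  moreover have "{0, 1} \<in> gedges (cycle_graph 5)" "0 \<in> gverts (cycle_graph 5)"
    "1 \<in> gverts (cycle_graph 5)"
    by (auto simp: cycle_graph_def intro!: exI[of _ 0])
  ultimately show False by (fastforce simp: is_minor_def)
qed

lemma graphs_of_size_Ex_C5_nonempty: "graphs_of_size (Ex_minor (cycle_graph 5)) n \<noteq> {}"
proof -
  have "({1..n}, {}) \<in> graphs_of_size (Ex_minor (cycle_graph 5)) n"
    by (simp add: graphs_of_size_def Ex_minor_def simple_graph_def edgeless_not_minor_cycle5)
  then show ?thesis by blast
qed

end

theory Submission
  imports Defs "HOL-Real_Asymp.Real_Asymp"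
begin

text \<open>
  A graph is in \<open>Ex(C\<^sub>5)\<close> iff it has no cycle of length at least 5. We count the pairs \<open>(G, v)\<close> with
  \<open>deg v = d\<close> by double counting. Let \<open>Q\<close> be the neighbours of \<open>v\<close> in one component of \<open>G - v\<close>.
  Two of them are only joined by paths of length at most 2, hence either \<open>Q\<close> is small (at most two
  vertices, or a triangle), or all of \<open>Q\<close> hangs on a hub \<open>w\<close> and deleting the edges between \<open>w\<close> and
  \<open>Q\<close> makes \<open>w\<close> and the vertices of \<open>Q\<close> pairwise disconnected. Delete the edges at \<open>v\<close> and those
  hub edges, and join every small \<open>Q\<close> of size two by an edge. With \<open>a\<close> neighbours split from \<open>k\<close>
  hubs and \<open>s\<close> small sets this leaves \<open>p + 1 = a + k + s + 1\<close> pieces with a root each, where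
  \<open>d \<le> a + k + 3 s\<close>.

  Attaching the pieces in order of decreasing size, each by an edge from its root to an arbitrary
  vertex outside the pieces still to be attached, creates only bridges and can be done in about
  \<open>(n / e)\<^sup>p\<close> ways. Conversely \<open>(G, v)\<close> is recovered from the resulting graph, the set of the \<open>p\<close> new
  edges among \<open>O(n)\<close> edges, one root, the assignment of the split neighbours to the hubs
  (\<open>k\<^sup>a\<close> ways) and \<open>O(1)\<close> information per root; a small \<open>Q\<close> is a clique, so it is contained
  in the bounded set of later neighbours of its first vertex in a degeneracy order. So at most a
  fraction \<open>n C\<^sup>d k\<^sup>a / p! \<le> n (C' / ln d)\<^sup>d\<close> of the graphs has a vertex of degree \<open>d\<close>,
  and this is \<open>o(1)\<close>, also after summation, for \<open>d \<ge> (1 + \<epsilon>) ln n / ln (ln (ln n))\<close>.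
\<close>

section \<open>Cycles and minors\<close>

definition adj :: "'a set set \<Rightarrow> ('a \<times> 'a) set" where
  "adj E = {(x, y). {x, y} \<in> E}"

definition gpath :: "'a set set \<Rightarrow> 'a list \<Rightarrow> bool" where
  "gpath E xs \<longleftrightarrow> xs \<noteq> [] \<and> distinct xs \<and> successively (\<lambda>x y. {x, y} \<in> E) xs"

definition gcycle :: "'a set set \<Rightarrow> 'a list \<Rightarrow> bool" where
  "gcycle E xs \<longleftrightarrow> gpath E xs \<and> 3 \<le> length xs \<and> {last xs, hd xs} \<in> E"

definition no_long_cycle :: "'a set set \<Rightarrow> bool" where
  "no_long_cycle E \<longleftrightarrow> (\<forall>xs. gcycle E xs \<longrightarrow> length xs < 5)"

lemma sym_adj: "sym (adj E)"
  by (auto simp: adj_def sym_def insert_commute)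

lemma conn_sym: "(x, y) \<in> (adj E)\<^sup>* \<Longrightarrow> (y, x) \<in> (adj E)\<^sup>*"
  using sym_rtrancl[OF sym_adj] by (metis symD)

lemma adj_mono: "E \<subseteq> E' \<Longrightarrow> adj E \<subseteq> adj E'"
  by (auto simp: adj_def)

lemma conn_mono: "(x, y) \<in> (adj E)\<^sup>* \<Longrightarrow> E \<subseteq> E' \<Longrightarrow> (x, y) \<in> (adj E')\<^sup>*"
  using rtrancl_mono[OF adj_mono] by blast

lemma gpath_mono: "gpath E xs \<Longrightarrow> E \<subseteq> E' \<Longrightarrow> gpath E' xs"
  by (auto simp: gpath_def intro: successively_mono)

lemma gcycle_mono: "gcycle E xs \<Longrightarrow> E \<subseteq> E' \<Longrightarrow> gcycle E' xs"
  by (auto simp: gcycle_def intro: gpath_mono)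

lemma no_long_cycle_mono: "no_long_cycle E' \<Longrightarrow> E \<subseteq> E' \<Longrightarrow> no_long_cycle E"
  by (meson gcycle_mono no_long_cycle_def)

lemma gpath_append:
  "xs \<noteq> [] \<Longrightarrow> ys \<noteq> [] \<Longrightarrow>
   gpath E (xs @ ys) \<longleftrightarrow> gpath E xs \<and> gpath E ys \<and> set xs \<inter> set ys = {} \<and> {last xs, hd ys} \<in> E"
  by (auto simp: gpath_def successively_append_iff)

lemma gpath_Cons:
  "xs \<noteq> [] \<Longrightarrow> gpath E (x # xs) \<longleftrightarrow> gpath E xs \<and> x \<notin> set xs \<and> {x, hd xs} \<in> E"
  by (auto simp: gpath_def successively_Cons)

lemma gpath_single [simp]: "gpath E [x]"
  by (simp add: gpath_def)

lemma gpath_snoc: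
  "xs \<noteq> [] \<Longrightarrow> gpath E (xs @ [x]) \<longleftrightarrow> gpath E xs \<and> x \<notin> set xs \<and> {last xs, x} \<in> E"
  by (auto simp: gpath_append)

lemma gpath_prefix:
  assumes "gpath E xs" "x \<in> set xs"
  obtains ys zs where "xs = ys @ x # zs" "gpath E (ys @ [x])" "hd (ys @ [x]) = hd xs"
proof -
  obtain ys zs where *: "xs = ys @ x # zs"
    using assms(2) by (meson split_list)
  have "gpath E (ys @ [x])"
    using assms(1) unfolding * gpath_def by (auto simp: successively_append_iff)
  then show ?thesis using that[OF *] * by (cases ys) auto
qed

lemma gpath_exists:
  assumes "(a, b) \<in> (adj E)\<^sup>*"
  obtains xs where "gpath E xs" "hd xs = a" "last xs = b"
proof -
  have "\<exists>xs. gpath E xs \<and> hd xs = a \<and> last xs = b"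
    using assms
  proof (induction rule: rtrancl_induct)
    case base
    show ?case by (intro exI[of _ "[a]"]) auto
  next
    case (step y z)
    then obtain xs where xs: "gpath E xs" "hd xs = a" "last xs = y" by blast
    show ?case
    proof (cases "z \<in> set xs")
      case True
      then show ?thesis using gpath_prefix[OF xs(1) True] xs(2) by (metis last_snoc)
    next
      case False
      have "xs \<noteq> []" using xs(1) by (auto simp: gpath_def)
      then have "gpath E (xs @ [z])"
        using False xs step(2) by (auto simp: gpath_snoc adj_def)
      then show ?thesis using xs(2) \<open>xs \<noteq> []\<close> by (intro exI[of _ "xs @ [z]"]) auto
    qed
  qed
  then show ?thesis using that by blast
qed

lemma gpath_closed:
  assumes "gpath E xs" "hd xs \<in> A" "\<And>x y. x \<in> A \<Longrightarrow> {x, y} \<in> E \<Longrightarrow> y \<in> A"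
  shows "set xs \<subseteq> A"
  using assms(1,2)
proof (induction xs)
  case (Cons x xs)
  show ?case
  proof (cases "xs = []")
    case False
    then show ?thesis using Cons assms(3) by (auto simp: gpath_Cons)
  qed (use Cons in auto)
qed simp

lemma conn_if_gpath:
  assumes "gpath E xs" "x \<in> set xs"
  shows "(hd xs, x) \<in> (adj E)\<^sup>*"
proof -
  have "set xs \<subseteq> {x. (hd xs, x) \<in> (adj E)\<^sup>*}"
    by (rule gpath_closed[OF assms(1)]) (auto simp: adj_def intro: rtrancl.rtrancl_into_rtrancl)
  then show ?thesis using assms(2) by blast
qed

text \<open>A cycle that uses the new edge can be rotated so that this edge joins its last vertex to
  its first. The rotated list is then a path in \<open>E\<close> between \<open>a\<close> and
  \<open>b\<close>.\<close>

lemma gcycle_insert_cases: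
  assumes "gcycle (insert {a, b} E) xs"
  obtains "gcycle E xs"
  | ys where "gpath E ys" "{hd ys, last ys} = {a, b}" "length ys = length xs"
proof -
  \<comment> \<open>In a list of at least three distinct vertices the closing pair differs from
    every pair of consecutive vertices, so the path itself does not use the new edge.\<close>
  have avoid: "gpath E ys"
    if ys: "gpath (insert {a, b} E) ys" "3 \<le> length ys" "{last ys, hd ys} = {a, b}" for ys
  proof -
    have "successively (\<lambda>x y. {x, y} \<in> E) ys"
      unfolding successively_conv_nth
    proof (intro allI impI)
      fix i assume i: "Suc i < length ys"
      have d: "distinct ys" "ys \<noteq> []" using ys by (auto simp: gpath_def)
      have "{ys ! i, ys ! Suc i} \<in> insert {a, b} E"
        using ys(1) i by (auto simp: gpath_def successively_conv_nth)
      moreover have "{ys ! i, ys ! Suc i} \<noteq> {ys ! (length ys - 1), ys ! 0}"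
        using d i ys(2) by (auto simp: doubleton_eq_iff nth_eq_iff_index_eq)
      ultimately show "{ys ! i, ys ! Suc i} \<in> E"
        using ys(3) d by (auto simp: last_conv_nth hd_conv_nth)
    qed
    then show ?thesis using ys(1) by (auto simp: gpath_def)
  qed
  have xs: "gpath (insert {a, b} E) xs" "3 \<le> length xs" "{last xs, hd xs} \<in> insert {a, b} E"
    using assms by (auto simp: gcycle_def)
  show ?thesis
  proof (cases "{last xs, hd xs} = {a, b}")
    case True
    then show ?thesis using avoid[OF xs(1,2)] that(2)[of xs] by (auto simp: insert_commute)
  next
    case False
    show ?thesis
    proof (cases "gpath E xs")
      case True
      then show ?thesis using False xs that(1) by (auto simp: gcycle_def)
    next
      case notE: False
      then obtain i where i: "Suc i < length xs" "{xs ! i, xs ! Suc i} \<notin> E"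
        using xs(1) by (auto simp: gpath_def successively_conv_nth)
      then have e: "{xs ! i, xs ! Suc i} = {a, b}"
        using xs(1) by (auto simp: gpath_def successively_conv_nth)
      define P Q where "P = take (Suc i) xs" and "Q = drop (Suc i) xs"
      have "last P = xs ! i" using i by (simp add: P_def take_Suc_conv_app_nth)
      then have PQ: "xs = P @ Q" "P \<noteq> []" "Q \<noteq> []" "last P = xs ! i" "hd Q = xs ! Suc i"
        using i by (auto simp: P_def Q_def hd_drop_conv_nth)
      have "gpath (insert {a, b} E) (Q @ P)"
        using xs PQ by (auto simp: gpath_append)
      then have "gpath E (Q @ P)"
        by (rule avoid) (use PQ xs(2) e in auto)
      then show ?thesis
        by (rule that(2)) (use PQ xs(2) e in \<open>auto simp: insert_commute\<close>)
    qed
  qed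
qed

text \<open>A cycle through the new edge would leave a path between its ends, which lie in different
  components.\<close>

lemma no_long_cycle_insert_bridge:
  assumes "no_long_cycle E" "(a, b) \<notin> (adj E)\<^sup>*"
  shows "no_long_cycle (insert {a, b} E)"
  unfolding no_long_cycle_def
proof (intro allI impI)
  fix xs assume "gcycle (insert {a, b} E) xs"
  then show "length xs < 5"
  proof (cases rule: gcycle_insert_cases)
    case 1
    then show ?thesis using assms(1) by (auto simp: no_long_cycle_def)
  next
    case (2 ys)
    then have "(hd ys, last ys) \<in> (adj E)\<^sup>*"
      using conn_if_gpath[of E ys "last ys"] by (auto simp: gpath_def)
    then have "(a, b) \<in> (adj E)\<^sup>*"
      using 2(2) conn_sym by (auto simp: doubleton_eq_iff)
    then show ?thesis using assms(2) by simp
  qed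
qed

text \<open>Adding \<open>v\<close> to the path gives a cycle with \<open>length xs + 1\<close>
  vertices.\<close>

lemma cycle_through_vertex:
  assumes "no_long_cycle E" "gpath E xs" "v \<notin> set xs" "{v, hd xs} \<in> E" "{v, last xs} \<in> E"
    "hd xs \<noteq> last xs"
  shows "length xs \<le> 3"
proof -
  have ne: "xs \<noteq> []" using assms by (auto simp: gpath_def)
  then have "length xs \<ge> 2" using assms(6) by (cases xs rule: list.exhaust; cases "tl xs") auto
  then have "gcycle E (v # xs)"
    using assms ne by (auto simp: gcycle_def gpath_Cons insert_commute)
  then show ?thesis using assms(1) by (force simp: no_long_cycle_def)
qed

section \<open>Equivalence of a 5-cycle minor and a cycle of length at least five\<close>

lemma cycle5_edge_iff:
  assumes "x < 5" "y < 5"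
  shows "{x, y} \<in> gedges (cycle_graph 5) \<longleftrightarrow> y = (x + 1) mod 5 \<or> x = (y + 1) mod 5"
proof -
  have "{x, y} \<in> gedges (cycle_graph 5) \<longleftrightarrow>
      (\<exists>i<5. x = i \<and> y = (i + 1) mod 5 \<or> x = (i + 1) mod 5 \<and> y = i)"
    unfolding cycle_graph_def snd_conv mem_Collect_eq doubleton_eq_iff by blast
  then show ?thesis using assms by blast
qed

text \<open>Each branch set contains a path from the vertex where the model cycle enters it to the
  vertex where it leaves. These five paths are disjoint and nonempty, so joined cyclically they form
  a cycle with at least five vertices.\<close>

lemma long_cycle_if_minor:
  assumes "is_minor (cycle_graph 5) G"
  shows "\<not> no_long_cycle (gedges G)"
proof -
  define E where "E = gedges G"
  obtain B where B: "disjoint_family_on B {..<5::nat}" "\<And>i. i < 5 \<Longrightarrow> connected_in G (B i)"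
    and edge: "\<And>x y. x < 5 \<Longrightarrow> y < 5 \<Longrightarrow> {x, y} \<in> gedges (cycle_graph 5) \<Longrightarrow>
        \<exists>u\<in>B x. \<exists>v\<in>B y. {u, v} \<in> E"
    using assms unfolding is_minor_def E_def by (auto simp: cycle_graph_def)
  have "\<forall>i. \<exists>u v. i < 5 \<longrightarrow> u \<in> B i \<and> v \<in> B ((i + 1) mod 5) \<and> {u, v} \<in> E"
  proof
    fix i show "\<exists>u v. i < 5 \<longrightarrow> u \<in> B i \<and> v \<in> B ((i + 1) mod 5) \<and> {u, v} \<in> E"
      using edge[of i "(i + 1) mod 5"] cycle5_edge_iff[of i "(i + 1) mod 5"] by auto
  qed
  then obtain s t where st: "\<And>i. i < 5 \<Longrightarrow> s i \<in> B i \<and> t i \<in> B ((i + 1) mod 5) \<and> {s i, t i} \<in> E"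
    by metis
  have path: "\<exists>xs. gpath E xs \<and> hd xs = a \<and> last xs = b \<and> set xs \<subseteq> B i"
    if "i < 5" "a \<in> B i" "b \<in> B i" for i a b
  proof -
    let ?E = "{e \<in> E. e \<subseteq> B i}"
    have "{(x, y). x \<in> B i \<and> y \<in> B i \<and> {x, y} \<in> gedges G} = adj ?E"
      by (auto simp: adj_def E_def)
    then have "(a, b) \<in> (adj ?E)\<^sup>*"
      using B(2)[OF that(1)] that by (auto simp: connected_in_def)
    then obtain xs where xs: "gpath ?E xs" "hd xs = a" "last xs = b" by (rule gpath_exists)
    have "set xs \<subseteq> B i" by (rule gpath_closed[OF xs(1)]) (use xs that in auto)
    moreover have "gpath E xs" using xs(1) by (rule gpath_mono) auto
    ultimately show ?thesis using xs by blast
  qed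
  \<comment> \<open>The index \<open>(i + 4) mod 5\<close> is the predecessor of \<open>i\<close>,
    so \<open>t ((i + 4) mod 5)\<close> is the entry vertex of \<open>B i\<close>, and
    \<open>s i\<close> is its exit vertex.\<close>
  have "\<exists>P. gpath E P \<and> hd P = t ((i + 4) mod 5) \<and> last P = s i \<and> set P \<subseteq> B i" if "i < 5" for i
  proof -
    have "((i + 4) mod 5 + 1) mod 5 = i" using that by presburger
    then show ?thesis using path[OF that, of "t ((i + 4) mod 5)" "s i"] st[of i] st[of "(i + 4) mod 5"] that
      by auto
  qed
  then obtain P where P: "\<And>i. i < 5 \<Longrightarrow> gpath E (P i) \<and> hd (P i) = t ((i + 4) mod 5) \<and> last (P i) = s i \<and> set (P i) \<subseteq> B i"
    by metis
  have ne: "P i \<noteq> []" if "i < 5" for i using P[OF that] by (auto simp: gpath_def)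
  have disj: "set (P i) \<inter> set (P j) = {}" if "i < 5" "j < 5" "i \<noteq> j" for i j
    using P[OF that(1)] P[OF that(2)] B(1) that unfolding disjoint_family_on_def by blast
  have e: "{last (P i), hd (P ((i + 1) mod 5))} \<in> E" if "i < 5" for i
  proof -
    have "((i + 1) mod 5 + 4) mod 5 = i" "(i + 1) mod 5 < 5" using that by presburger+
    then show ?thesis using P[OF that] P[of "(i + 1) mod 5"] st[OF that] by auto
  qed
  let ?xs = "P 0 @ P 1 @ P 2 @ P 3 @ P 4"
  have "gpath E ?xs"
    using P[of 0] P[of 1] P[of 2] P[of 3] P[of 4] ne[of 0] ne[of 1] ne[of 2] ne[of 3] ne[of 4]
      e[of 0] e[of 1] e[of 2] e[of 3] disj[of 0 1] disj[of 0 2] disj[of 0 3] disj[of 0 4]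
      disj[of 1 2] disj[of 1 3] disj[of 1 4] disj[of 2 3] disj[of 2 4] disj[of 3 4]
    by (simp add: gpath_append Int_Un_distrib numeral_2_eq_2)
  moreover have "length ?xs \<ge> 5"
    using ne[of 0] ne[of 1] ne[of 2] ne[of 3] ne[of 4]
    by (simp add: Suc_le_eq flip: length_greater_0_conv)
  ultimately have "gcycle E ?xs"
    using e[of 4] ne[of 0] ne[of 4] by (simp add: gcycle_def)
  then show ?thesis
    using \<open>length ?xs \<ge> 5\<close> unfolding no_long_cycle_def E_def by (meson not_le)
qed

text \<open>Four consecutive vertices of a long cycle serve as singleton branch sets; the rest of
  the cycle is a nonempty path and serves as the fifth.\<close>

lemma minor_if_long_cycle:
  assumes "simple_graph G" "\<not> no_long_cycle (gedges G)"
  shows "is_minor (cycle_graph 5) G"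
proof -
  define E where "E = gedges G"
  obtain xs where xs: "gcycle E xs" "5 \<le> length xs"
    using assms(2) by (auto simp: no_long_cycle_def E_def not_less)
  have p: "gpath E xs" "{last xs, hd xs} \<in> E" using xs by (auto simp: gcycle_def)
  then have d: "distinct xs" "xs \<noteq> []" by (auto simp: gpath_def)
  have suc: "{xs ! i, xs ! Suc i} \<in> E" if "Suc i < length xs" for i
    using p that by (auto simp: gpath_def successively_conv_nth)
  have sub: "set xs \<subseteq> gverts G"
  proof
    fix x assume "x \<in> set xs"
    then obtain i where i: "i < length xs" "x = xs ! i" by (auto simp: in_set_conv_nth)
    have "\<exists>y. {x, y} \<in> E"
    proof (cases "Suc i < length xs")
      case True then show ?thesis using suc i by blast
    next
      case False
      then have "i = length xs - 1" using i by auto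
      then show ?thesis using i p(2) d by (auto simp: last_conv_nth)
    qed
    then show "x \<in> gverts G" using assms(1) by (auto simp: simple_graph_def E_def)
  qed
  define B where "B i = (if i < 4 then {xs ! i} else set (drop 4 xs))" for i :: nat
  have last_path: "connected_in G (set (drop 4 xs))"
    unfolding connected_in_def
  proof (intro conjI ballI)
    show "set (drop 4 xs) \<noteq> {}" using xs by auto
    show "set (drop 4 xs) \<subseteq> gverts G" using sub set_drop_subset by fast
    fix u v assume uv: "u \<in> set (drop 4 xs)" "v \<in> set (drop 4 xs)"
    let ?S = "set (drop 4 xs)"
    let ?E = "{e \<in> E. e \<subseteq> ?S}"
    have "successively (\<lambda>x y. {x, y} \<in> ?E) (drop 4 xs)"
      unfolding successively_conv_nth
    proof (intro allI impI)
      fix i assume i: "Suc i < length (drop 4 xs)"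
      then have "drop 4 xs ! i \<in> ?S" "drop 4 xs ! Suc i \<in> ?S" by (meson Suc_lessD nth_mem)+
      then show "{drop 4 xs ! i, drop 4 xs ! Suc i} \<in> ?E" using suc[of "4 + i"] i by auto
    qed
    then have q: "gpath ?E (drop 4 xs)" using d xs by (auto simp: gpath_def)
    have "(hd (drop 4 xs), u) \<in> (adj ?E)\<^sup>*" "(hd (drop 4 xs), v) \<in> (adj ?E)\<^sup>*"
      using conn_if_gpath[OF q] uv by auto
    then have "(u, v) \<in> (adj ?E)\<^sup>*" by (meson conn_sym rtrancl_trans)
    moreover have "adj ?E = {(x, y). x \<in> ?S \<and> y \<in> ?S \<and> {x, y} \<in> gedges G}"
      by (auto simp: adj_def E_def)
    ultimately show "(u, v) \<in> {(x, y). x \<in> ?S \<and> y \<in> ?S \<and> {x, y} \<in> gedges G}\<^sup>*" by simp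
  qed
  have B_edge: "\<exists>u\<in>B x. \<exists>v\<in>B ((x + 1) mod 5). {u, v} \<in> E" if x: "x < 5" for x
  proof -
    consider "x < 3" | "x = 3" | "x = 4" using x by linarith
    then show ?thesis
    proof cases
      case 1 then show ?thesis using suc[of x] xs(2) by (auto simp: B_def)
    next
      case 2
      have "xs ! 4 \<in> set (drop 4 xs)"
        using xs(2) by (metis Suc_le_lessD drop_eq_Nil2 eval_nat_numeral(3) hd_drop_conv_nth hd_in_set not_less)
      then show ?thesis using 2 suc[of 3] xs(2) by (auto simp: B_def)
    next
      case 3
      have "last xs \<in> set (drop 4 xs)"
        using xs(2) by (metis Suc_le_lessD drop_eq_Nil2 eval_nat_numeral(3) last_drop last_in_set not_less)
      then show ?thesis using 3 p(2) d by (auto simp: B_def hd_conv_nth)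
    qed
  qed
  show ?thesis
    unfolding is_minor_def
  proof (intro exI[of _ B] conjI ballI impI)
    show "disjoint_family_on B (gverts (cycle_graph 5))"
    proof -
      have "xs ! i \<notin> set (drop 4 xs)" if "i < 4" for i
      proof
        assume "xs ! i \<in> set (drop 4 xs)"
        then obtain j where "j + 4 < length xs" "xs ! i = xs ! (4 + j)"
          by (force simp: in_set_conv_nth less_diff_conv)
        then show False using that d(1) xs(2) by (auto simp: nth_eq_iff_index_eq)
      qed
      then show ?thesis
        using d(1) xs(2) by (auto simp: disjoint_family_on_def B_def nth_eq_iff_index_eq cycle_graph_def)
    qed
    fix x assume x: "x \<in> gverts (cycle_graph 5)"
    then have "x < 5" by (auto simp: cycle_graph_def)
    show "connected_in G (B x)"
      using last_path sub xs(2) by (auto simp: B_def connected_in_def)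
    fix y assume y: "y \<in> gverts (cycle_graph 5)" "{x, y} \<in> gedges (cycle_graph 5)"
    then have "y < 5" by (auto simp: cycle_graph_def)
    then consider "y = (x + 1) mod 5" | "x = (y + 1) mod 5"
      using y(2) \<open>x < 5\<close> cycle5_edge_iff by blast
    then show "\<exists>u\<in>B x. \<exists>v\<in>B y. {u, v} \<in> gedges G"
    proof cases
      case 1
      then show ?thesis using B_edge[OF \<open>x < 5\<close>] by (simp add: E_def)
    next
      case 2
      then obtain u v where "u \<in> B y" "v \<in> B x" "{u, v} \<in> E"
        using B_edge[OF \<open>y < 5\<close>] by auto
      moreover have "{v, u} = {u, v}" by blast
      ultimately show ?thesis unfolding E_def by metis
    qed
  qed
qed

definition no_long_cycle_edges :: "nat \<Rightarrow> nat set set set" where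
  "no_long_cycle_edges n = {E. (\<forall>e\<in>E. e \<subseteq> {1..n} \<and> card e = 2) \<and> no_long_cycle E}"

lemma graphs_of_size_Ex_C5:
  "graphs_of_size (Ex_minor (cycle_graph 5)) n = Pair {1..n} ` no_long_cycle_edges n"
proof -
  have "G \<in> graphs_of_size (Ex_minor (cycle_graph 5)) n \<longleftrightarrow>
      gverts G = {1..n} \<and> gedges G \<in> no_long_cycle_edges n" for G :: "nat ugraph"
    using minor_if_long_cycle[of G] long_cycle_if_minor[of G]
    by (auto simp: graphs_of_size_def Ex_minor_def no_long_cycle_edges_def simple_graph_def)
  then show ?thesis by (auto simp: image_iff prod_eq_iff)
qed

section \<open>Degeneracy and separating hubs\<close>

text \<open>Take a longest path. All neighbours of its first vertex lie on it, and a neighbour at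
  index \<open>j \<ge> 2\<close> closes a cycle with \<open>j + 1\<close> vertices, so
  \<open>j\<close> is 1, 2 or 3.\<close>

lemma exists_small_degree:
  assumes "finite V" "V \<noteq> {}" "\<And>e. e \<in> E \<Longrightarrow> e \<subseteq> V \<and> card e = 2" "no_long_cycle E"
  shows "\<exists>u\<in>V. card {w. {u, w} \<in> E} \<le> 3"
proof -
  let ?P = "\<lambda>xs. gpath E xs \<and> set xs \<subseteq> V"
  obtain v where "v \<in> V" using assms(2) by blast
  then have ex: "?P [v]" by simp
  have "length xs \<le> card V" if "?P xs" for xs
    using that assms(1) by (metis card_mono distinct_card gpath_def)
  then obtain xs where xs: "?P xs" and max: "\<And>ys. ?P ys \<Longrightarrow> length ys \<le> length xs"
    using ex_has_greatest_nat[of ?P "[v]" length "Suc (card V)"] ex by (metis less_Suc_eq_le)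
  have ne: "xs \<noteq> []" and d: "distinct xs" using xs by (auto simp: gpath_def)
  define u where "u = hd xs"
  have "{w. {u, w} \<in> E} \<subseteq> (!) xs ` {1, 2, 3}"
  proof
    fix w assume "w \<in> {w. {u, w} \<in> E}"
    then have w: "{u, w} \<in> E" by simp
    then have "w \<in> V" using assms(3) by blast
    have "u \<noteq> w" using assms(3)[OF w] by auto
    have "w \<in> set xs"
    proof (rule ccontr)
      assume "w \<notin> set xs"
      then have "?P (w # xs)"
        using xs ne w \<open>w \<in> V\<close> by (auto simp: gpath_Cons u_def insert_commute)
      then show False using max by fastforce
    qed
    then obtain ys zs where ys: "xs = ys @ w # zs" "gpath E (ys @ [w])" "hd (ys @ [w]) = u"
      using gpath_prefix xs unfolding u_def by metis
    have "ys \<noteq> []" using ys(3) \<open>u \<noteq> w\<close> by auto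
    have "length ys \<le> 3"
    proof (rule ccontr)
      assume "\<not> length ys \<le> 3"
      then have "gcycle E (ys @ [w])" using ys w by (auto simp: gcycle_def insert_commute)
      then show False using assms(4) \<open>\<not> length ys \<le> 3\<close> by (force simp: no_long_cycle_def)
    qed
    moreover have "w = xs ! length ys" using ys(1) by simp
    moreover have "length ys \<noteq> 0" using \<open>ys \<noteq> []\<close> by simp
    ultimately show "w \<in> (!) xs ` {1, 2, 3}"
      by (metis (no_types, lifting) One_nat_def Suc_1 image_eqI insertCI le_SucE le_zero_eq numeral_3_eq_3)
  qed
  then have "card {w. {u, w} \<in> E} \<le> card ((!) xs ` {1, 2, 3})"
    by (intro card_mono) auto
  also have "\<dots> \<le> card {1, 2, 3 :: nat}" by (rule card_image_le) simp
  finally show ?thesis using xs ne by (intro bexI[of _ u]) (auto simp: u_def)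
qed

text \<open>A vertex of degree at most 3 gets rank 0, and the ranks in an order of the remaining
  graph are shifted up by one.\<close>

lemma exists_degeneracy_order:
  assumes "finite V" "\<And>e. e \<in> E \<Longrightarrow> e \<subseteq> V \<and> card e = 2" "no_long_cycle E"
  shows "\<exists>\<rho> :: 'a \<Rightarrow> nat. inj_on \<rho> V \<and> (\<forall>u\<in>V. card {w. {u, w} \<in> E \<and> \<rho> u < \<rho> w} \<le> 3)"
  using assms
proof (induction "card V" arbitrary: V E)
  case 0
  then show ?case by auto
next
  case (Suc m)
  then have "V \<noteq> {}" by auto
  then obtain u where u: "u \<in> V" "card {w. {u, w} \<in> E} \<le> 3"
    using exists_small_degree[of V E] Suc.prems by blast
  let ?V = "V - {u}" and ?E = "{e \<in> E. u \<notin> e}"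
  have "\<exists>\<rho> :: 'a \<Rightarrow> nat. inj_on \<rho> ?V \<and> (\<forall>x\<in>?V. card {w. {x, w} \<in> ?E \<and> \<rho> x < \<rho> w} \<le> 3)"
  proof (rule Suc.hyps(1))
    show "e \<subseteq> ?V \<and> card e = 2" if "e \<in> ?E" for e using Suc.prems(2)[of e] that by blast
    show "no_long_cycle ?E" using Suc.prems(3) by (rule no_long_cycle_mono) blast
  qed (use Suc u in auto)
  then obtain \<rho> :: "'a \<Rightarrow> nat" where r: "inj_on \<rho> ?V"
      "\<And>x. x \<in> ?V \<Longrightarrow> card {w. {x, w} \<in> ?E \<and> \<rho> x < \<rho> w} \<le> 3" by blast
  define \<rho>' where "\<rho>' x = (if x = u then 0 else Suc (\<rho> x))" for x
  have "inj_on \<rho>' V" using r(1) by (auto simp: inj_on_def \<rho>'_def)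
  moreover have "card {w. {x, w} \<in> E \<and> \<rho>' x < \<rho>' w} \<le> 3" if "x \<in> V" for x
  proof (cases "x = u")
    case True
    have "{w. {u, w} \<in> E} \<subseteq> V" using Suc.prems(2) by blast
    then have "finite {w. {u, w} \<in> E}" using Suc.prems(1) finite_subset by blast
    then have "card {w. {x, w} \<in> E \<and> \<rho>' x < \<rho>' w} \<le> card {w. {u, w} \<in> E}"
      using True by (intro card_mono) auto
    then show ?thesis using u by simp
  next
    case False
    then have "{w. {x, w} \<in> E \<and> \<rho>' x < \<rho>' w} = {w. {x, w} \<in> ?E \<and> \<rho> x < \<rho> w}"
      by (auto simp: \<rho>'_def split: if_splits)
    then show ?thesis using r(2)[of x] that False by simp
  qed
  ultimately show ?case by blast
qed

text \<open>The choice operator makes the order a function of the graph, so recovering the graph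
  also recovers the order.\<close>

definition degen_order :: "'a set \<Rightarrow> 'a set set \<Rightarrow> 'a \<Rightarrow> nat" where
  "degen_order V E = (SOME \<rho>. inj_on \<rho> V \<and> (\<forall>u\<in>V. card {w. {u, w} \<in> E \<and> \<rho> u < \<rho> w} \<le> 3))"

definition later_nbrs :: "'a set \<Rightarrow> 'a set set \<Rightarrow> 'a \<Rightarrow> 'a set" where
  "later_nbrs V E u = {w. {u, w} \<in> E \<and> degen_order V E u < degen_order V E w}"

context
  fixes V :: "'a set" and E
  assumes V: "finite V" and E: "\<And>e. e \<in> E \<Longrightarrow> e \<subseteq> V \<and> card e = 2" and nlc: "no_long_cycle E"
begin

lemma degen_order:
  shows degen_order_inj: "inj_on (degen_order V E) V"
    and card_later_nbrs: "u \<in> V \<Longrightarrow> card (later_nbrs V E u) \<le> 3"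
  using someI_ex[OF exists_degeneracy_order[OF V E nlc]]
  unfolding degen_order_def[symmetric] later_nbrs_def by auto

lemma later_nbrs_subset: "later_nbrs V E u \<subseteq> V"
  using E by (auto simp: later_nbrs_def)

text \<open>The order directs every edge to its later end, with at most three edges leaving each
  vertex, and \<open>adj E\<close> contains both orientations.\<close>

lemma card_arcs_le: "finite (adj E)" "card (adj E) \<le> 6 * card V"
proof -
  let ?A = "SIGMA u:V. later_nbrs V E u"
  have fin: "finite (later_nbrs V E u)" for u
    using later_nbrs_subset V by (rule finite_subset)
  have "card ?A = (\<Sum>u\<in>V. card (later_nbrs V E u))"
    using V fin by (intro card_SigmaI) auto
  also have "\<dots> \<le> (\<Sum>u\<in>V. 3)" using card_later_nbrs by (intro sum_mono)
  finally have A: "card ?A \<le> 3 * card V" by simp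
  have "finite ?A" using V fin by blast
  have sub: "adj E \<subseteq> ?A \<union> prod.swap ` ?A"
  proof
    fix z assume "z \<in> adj E"
    then obtain x y where z: "z = (x, y)" and xy: "{x, y} \<in> E" by (auto simp: adj_def)
    then have "x \<in> V" "y \<in> V" "x \<noteq> y" using E[OF xy] by auto
    then have "degen_order V E x \<noteq> degen_order V E y"
      using degen_order_inj by (auto dest: inj_onD)
    then show "z \<in> ?A \<union> prod.swap ` ?A"
      using \<open>x \<in> V\<close> \<open>y \<in> V\<close> xy z
      by (cases "degen_order V E x < degen_order V E y")
        (auto simp: later_nbrs_def insert_commute image_iff)
  qed
  show "finite (adj E)" using sub \<open>finite ?A\<close> by (meson finite_Un finite_imageI finite_subset)
  have "card (adj E) \<le> card (?A \<union> prod.swap ` ?A)"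
    using sub \<open>finite ?A\<close> by (intro card_mono) auto
  also have "\<dots> \<le> card ?A + card (prod.swap ` ?A)" by (rule card_Un_le)
  also have "\<dots> \<le> card ?A + card ?A" using card_image_le[OF \<open>finite ?A\<close>] by simp
  finally show "card (adj E) \<le> 6 * card V" using A by simp
qed

text \<open>The first vertex of the clique in the order has all others as later neighbours. So a
  clique can be encoded by one vertex and a subset of a bounded set.\<close>

lemma clique_subset_later_nbrs:
  assumes "Q \<subseteq> V" "Q \<noteq> {}" "\<And>x y. x \<in> Q \<Longrightarrow> y \<in> Q \<Longrightarrow> x \<noteq> y \<Longrightarrow> {x, y} \<in> E"
  shows "\<exists>r\<in>Q. Q \<subseteq> insert r (later_nbrs V E r)"
proof -
  have "finite Q" using assms V finite_subset by blast
  define r where "r = arg_min_on (degen_order V E) Q"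
  have r: "r \<in> Q" "\<And>x. x \<in> Q \<Longrightarrow> degen_order V E r \<le> degen_order V E x"
    unfolding r_def using arg_min_if_finite[OF \<open>finite Q\<close> assms(2), of "degen_order V E"] by (auto simp: not_less)
  have "x \<in> later_nbrs V E r" if "x \<in> Q" "x \<noteq> r" for x
    using r that assms inj_onD[OF degen_order_inj, of r x]
    by (force simp: later_nbrs_def order_less_le)
  then show ?thesis using r(1) by blast
qed

end

section \<open>The hub of the neighbours in one component\<close>

lemma list_of_length_2: "length xs = 2 \<Longrightarrow> xs = [hd xs, last xs]"
  by (auto simp: numeral_2_eq_2 length_Suc_conv)

text \<open>Short paths force a star: either a vertex of \<open>Y\<close> is adjacent to the rest of
  \<open>Y\<close>, or \<open>Y\<close> is independent with a common neighbour. A connection left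
  after deleting the star would extend through \<open>w\<close> to a path that is too long, close a
  triangle in \<open>Y\<close>, or be a deleted edge.\<close>

lemma exists_separating_hub:
  assumes Y: "3 \<le> card Y"
    and conn: "\<And>x y. x \<in> Y \<Longrightarrow> y \<in> Y \<Longrightarrow> (x, y) \<in> (adj E)\<^sup>*"
    and short: "\<And>xs. gpath E xs \<Longrightarrow> hd xs \<in> Y \<Longrightarrow> last xs \<in> Y \<Longrightarrow> hd xs \<noteq> last xs \<Longrightarrow> length xs \<le> 3"
    and no_triangle: "card Y = 3 \<Longrightarrow> \<exists>x\<in>Y. \<exists>y\<in>Y. x \<noteq> y \<and> {x, y} \<notin> E"
    and simple: "\<And>e. e \<in> E \<Longrightarrow> card e = 2"
  shows "\<exists>w. (\<forall>y\<in>Y - {w}. {w, y} \<in> E) \<and>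
    (\<forall>x\<in>insert w Y. \<forall>y\<in>insert w Y. x \<noteq> y \<longrightarrow>
      (x, y) \<notin> (adj (E - {{w, y} | y. y \<in> Y - {w}}))\<^sup>*)"
proof -
  have fin: "finite Y" using Y card.infinite by fastforce
  have irr: "{x, x} \<notin> E" for x using simple[of "{x, x}"] by auto
  have third: "\<exists>z\<in>Y. z \<noteq> x \<and> z \<noteq> y" for x y
  proof (rule ccontr)
    assume "\<not> ?thesis"
    then have "Y \<subseteq> {x, y}" by blast
    then have "card Y \<le> card {x, y}" by (intro card_mono) auto
    also have "\<dots> \<le> 2" by (simp add: card_insert_if)
    finally show False using Y by simp
  qed
  have no4: False if "distinct [a, b, c, d]" "a \<in> Y" "d \<in> Y" "{a, b} \<in> E" "{b, c} \<in> E" "{c, d} \<in> E"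
    for a b c d
    using short[of "[a, b, c, d]"] that by (auto simp: gpath_def)
  have link: "{x, y} \<in> E \<or> (\<exists>z. z \<noteq> x \<and> z \<noteq> y \<and> {x, z} \<in> E \<and> {z, y} \<in> E)"
    if xy: "x \<in> Y" "y \<in> Y" "x \<noteq> y" for x y
  proof -
    obtain xs where xs: "gpath E xs" "hd xs = x" "last xs = y"
      using conn[OF xy(1,2)] by (rule gpath_exists)
    then have "length xs \<le> 3" using short xy by blast
    then consider a where "xs = [a]" | a b where "xs = [a, b]" | a b c where "xs = [a, b, c]"
      using xs(1) by (cases xs; cases "tl xs"; cases "tl (tl xs)") (auto simp: gpath_def)
    then show ?thesis
      by cases (use xs xy in \<open>auto simp: gpath_def\<close>)
  qed
  \<comment> \<open>If \<open>z\<close> is not adjacent to \<open>x\<close>, the middle vertex of a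
    path from \<open>z\<close> to \<open>x\<close> must be \<open>y\<close>; otherwise appending
    \<open>y\<close> would give four vertices.\<close>
  have edge_or: "{z, x} \<in> E \<or> {z, y} \<in> E"
    if "x \<in> Y" "y \<in> Y" "z \<in> Y" "z \<noteq> x" "z \<noteq> y" "{x, y} \<in> E" for x y z
    using link[of z x] no4[of z _ x y] that irr[of x] by fastforce
  \<comment> \<open>A fourth vertex of \<open>Y\<close> would be adjacent to a corner of the
    triangle and start a path on four vertices. So \<open>Y\<close> is the triangle itself, against
    \<open>no_triangle\<close>.\<close>
  have clique_free: False
    if t: "x \<in> Y" "y \<in> Y" "z \<in> Y" "x \<noteq> y" "y \<noteq> z" "x \<noteq> z" "{x, y} \<in> E" "{y, z} \<in> E" "{x, z} \<in> E"
    for x y z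
  proof -
    have comm: "{a, b} \<in> E \<Longrightarrow> {b, a} \<in> E" for a b by (simp add: insert_commute)
    have "Y \<subseteq> {x, y, z}"
    proof
      fix u assume "u \<in> Y"
      show "u \<in> {x, y, z}"
      proof (rule ccontr)
        assume "u \<notin> {x, y, z}"
        then have "{u, x} \<in> E \<or> {u, y} \<in> E" using edge_or[of x y u] t \<open>u \<in> Y\<close> by auto
        then show False
          using no4[of u x y z] no4[of u y x z] t \<open>u \<in> Y\<close> \<open>u \<notin> {x, y, z}\<close> comm by auto
      qed
    qed
    then have Y3: "Y = {x, y, z}" using t by blast
    then have "card Y = 3" using t by simp
    then show False using no_triangle Y3 t comm by auto
  qed
  have "\<exists>w. (\<forall>y\<in>Y - {w}. {w, y} \<in> E) \<and> (w \<in> Y \<or> (\<forall>x\<in>Y. \<forall>y\<in>Y. {x, y} \<notin> E))"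
  proof (cases "\<exists>x\<in>Y. \<exists>y\<in>Y. {x, y} \<in> E")
    case True
    then obtain a b where ab: "a \<in> Y" "b \<in> Y" "{a, b} \<in> E" by blast
    have "a \<noteq> b" using ab irr by blast
    obtain c where c: "c \<in> Y" "c \<noteq> a" "c \<noteq> b" using third by blast
    \<comment> \<open>The middle vertex \<open>w\<close> of the path \<open>u\<close>,
      \<open>w\<close>, \<open>c\<close> in \<open>Y\<close> is the hub: a vertex \<open>y\<close>
      not adjacent to \<open>w\<close> would be adjacent to \<open>u\<close> and start the path
      \<open>y\<close>, \<open>u\<close>, \<open>w\<close>, \<open>c\<close>.\<close>
    have hub: "\<forall>y\<in>Y - {w}. {w, y} \<in> E"
      if w: "w \<in> Y" "u \<in> Y" "c \<noteq> w" "c \<noteq> u" "w \<noteq> u" "{u, w} \<in> E" "{w, c} \<in> E" for u w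
    proof
      fix y assume y: "y \<in> Y - {w}"
      show "{w, y} \<in> E"
      proof (rule ccontr)
        assume n: "{w, y} \<notin> E"
        then have "y \<noteq> u" "y \<noteq> c" using w by (auto simp: insert_commute)
        then have "{y, u} \<in> E" using edge_or[of u w y] w y n by (auto simp: insert_commute)
        then show False using no4[of y u w c] w c y \<open>y \<noteq> u\<close> \<open>y \<noteq> c\<close> by auto
      qed
    qed
    have "{c, a} \<in> E \<or> {c, b} \<in> E" using edge_or[of a b c] ab c by auto
    then have "{b, a} \<in> E \<and> {a, c} \<in> E \<or> {a, b} \<in> E \<and> {b, c} \<in> E"
      using ab(3) by (auto simp: insert_commute)
    then show ?thesis using hub[of a b] hub[of b a] ab(1,2) c \<open>a \<noteq> b\<close> by metis
  next
    case indep: False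
    obtain a where a: "a \<in> Y" using Y fin by fastforce
    obtain b where b: "b \<in> Y" "b \<noteq> a" using third by blast
    \<comment> \<open>This common neighbour is the hub: another middle vertex \<open>z\<close>
      between \<open>y\<close> and \<open>a\<close> would give the path \<open>y\<close>,
      \<open>z\<close>, \<open>a\<close>, \<open>w\<close>, \<open>b\<close>.\<close>
    obtain w where w: "w \<noteq> a" "w \<noteq> b" "{a, w} \<in> E" "{w, b} \<in> E" using link[of a b] indep a b by blast
    have "w \<notin> Y" using indep a w by blast
    have "{w, y} \<in> E" if y: "y \<in> Y" for y
    proof (cases "y = a \<or> y = b")
      case True
      then show ?thesis using w by (auto simp: insert_commute)
    next
      case False
      obtain z where z: "{y, z} \<in> E" "{z, a} \<in> E" using link[of y a] indep y a False by blast
      show ?thesis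
      proof (cases "z = w")
        case True
        then show ?thesis using z by (simp add: insert_commute)
      next
        case zw: False
        have "z \<notin> Y" using indep a z by blast
        then have "gpath E [y, z, a, w, b]"
          using z w zw False \<open>w \<notin> Y\<close> y a b by (auto simp: gpath_def)
        then show ?thesis using short[of "[y, z, a, w, b]"] y b False by auto
      qed
    qed
    then show ?thesis using indep by blast
  qed
  then obtain w where hub: "\<And>y. y \<in> Y \<Longrightarrow> y \<noteq> w \<Longrightarrow> {w, y} \<in> E"
    and wY: "w \<in> Y \<or> (\<forall>x\<in>Y. \<forall>y\<in>Y. {x, y} \<notin> E)" by blast
  let ?E = "E - {{w, y} | y. y \<in> Y - {w}}"
  \<comment> \<open>No path between two vertices of \<open>Y\<close> avoids \<open>w\<close>. If
    \<open>w\<close> is in \<open>Y\<close>, appending it shows that the path is a single edge,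
    which forms a triangle with \<open>w\<close>. Otherwise \<open>w\<close> and a third vertex of
    \<open>Y\<close> can be put in front, giving at least four vertices.\<close>
  have A: False if xs: "gpath ?E xs" "hd xs \<in> Y" "last xs \<in> Y" "hd xs \<noteq> last xs" "w \<notin> set xs" for xs
  proof -
    have p: "gpath E xs" using xs(1) by (rule gpath_mono) blast
    have ne: "xs \<noteq> []" using p by (auto simp: gpath_def)
    have l3: "length xs \<le> 3" using short p xs by blast
    have l2: "2 \<le> length xs" using xs(4) ne by (cases xs; cases "tl xs") auto
    have hl: "hd xs \<noteq> w" "last xs \<noteq> w" using xs(5) ne by auto
    show False
    proof (cases "w \<in> Y")
      case True
      have "gpath E (xs @ [w])" using p ne xs hl hub[of "last xs"] by (auto simp: gpath_snoc insert_commute)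
      then have "length xs \<le> 2" using short[of "xs @ [w]"] xs ne True hl by (auto simp: hd_append)
      then have "xs = [hd xs, last xs]" using l2 by (intro list_of_length_2) simp
      then have "{hd xs, last xs} \<in> E" using p unfolding gpath_def by (metis successively.simps(3))
      then show False
        using clique_free[of "hd xs" "last xs" w] xs hl hub[of "hd xs"] hub[of "last xs"] True
        by (auto simp: insert_commute)
    next
      case False
      obtain y where y: "y \<in> Y" "y \<noteq> hd xs" "y \<noteq> last xs" using third by blast
      have "y \<notin> set xs"
      proof
        assume "y \<in> set xs"
        then have "xs = [hd xs, y, last xs]"
          using l3 y(2,3) by (cases xs; cases "tl xs"; cases "tl (tl xs)") (auto split: if_splits)
        then have "{hd xs, y} \<in> E" using p unfolding gpath_def by (metis successively.simps(3))
        then show False using wY False xs y by blast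
      qed
      then have "gpath E (y # w # xs)"
        using p ne xs False y hub[of y] hub[of "hd xs"] hl by (auto simp: gpath_Cons insert_commute)
      then show False using short[of "y # w # xs"] ne y xs l2 by auto
    qed
  qed
  \<comment> \<open>By \<open>A\<close> the path meets \<open>Y - {w}\<close> only in its first
    vertex, so a further vertex of \<open>Y\<close> can be appended after \<open>w\<close>. Hence
    the path is a single edge from \<open>Y\<close> to \<open>w\<close>, and those are
    deleted.\<close>
  have B: False if xs: "gpath ?E xs" "hd xs \<in> Y" "last xs = w" "hd xs \<noteq> w" for xs
  proof -
    have p: "gpath E xs" using xs(1) by (rule gpath_mono) blast
    have ne: "xs \<noteq> []" and d: "distinct xs" using p by (auto simp: gpath_def)
    have only: "y = hd xs" if y: "y \<in> set xs" "y \<in> Y" "y \<noteq> w" for y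
    proof (rule ccontr)
      assume "y \<noteq> hd xs"
      obtain ys zs where ys: "xs = ys @ y # zs" "gpath ?E (ys @ [y])" "hd (ys @ [y]) = hd xs"
        using gpath_prefix[OF xs(1) y(1)] .
      have "zs \<noteq> []" using ys(1) xs(3) y(3) by auto
      then have "w \<in> set zs" using ys(1) xs(3) by auto
      then have "w \<notin> set (ys @ [y])" using d ys(1) by auto
      then show False using A[OF ys(2)] ys(3) xs y \<open>y \<noteq> hd xs\<close> by auto
    qed
    obtain y where y: "y \<in> Y" "y \<noteq> hd xs" "y \<noteq> w" using third by blast
    then have "y \<notin> set xs" using only by blast
    then have "gpath E (xs @ [y])" using p ne xs y hub by (auto simp: gpath_snoc)
    then have "length xs \<le> 2" using short[of "xs @ [y]"] xs y ne by (auto simp: hd_append)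
    moreover have "2 \<le> length xs" using xs(3,4) ne by (cases xs; cases "tl xs") auto
    ultimately have "xs = [hd xs, w]" using xs(3) list_of_length_2[of xs] by simp
    then obtain a where a: "xs = [a, w]" by blast
    then have "{a, w} \<in> ?E" using xs(1) by (simp add: gpath_def)
    then show False using xs a by (auto simp: insert_commute)
  qed
  have B': "(x, w) \<notin> (adj ?E)\<^sup>*" if "x \<in> Y" "x \<noteq> w" for x
  proof
    assume "(x, w) \<in> (adj ?E)\<^sup>*"
    then obtain xs where "gpath ?E xs" "hd xs = x" "last xs = w" by (rule gpath_exists)
    then show False using B[of xs] that by blast
  qed
  have "(x, y) \<notin> (adj ?E)\<^sup>*" if xy: "x \<in> Y" "y \<in> Y" "x \<noteq> y" "x \<noteq> w" "y \<noteq> w" for x y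
  proof
    assume "(x, y) \<in> (adj ?E)\<^sup>*"
    then obtain xs where xs: "gpath ?E xs" "hd xs = x" "last xs = y" by (rule gpath_exists)
    then have "w \<in> set xs" using A[OF xs(1)] xy by blast
    then have "(x, w) \<in> (adj ?E)\<^sup>*" using conn_if_gpath[OF xs(1)] xs by auto
    then show False using B' xy by blast
  qed
  then have "\<forall>x\<in>insert w Y. \<forall>y\<in>insert w Y. x \<noteq> y \<longrightarrow> (x, y) \<notin> (adj ?E)\<^sup>*"
    using B' by (auto dest: conn_sym)
  then show ?thesis using hub by (intro exI[of _ w]) auto
qed

section \<open>Dismantling a graph at a vertex\<close>

text \<open>
  \<open>W\<close>: hubs; \<open>Y\<close>: split neighbours of \<open>v\<close>, with hub \<open>\<omega> y\<close>; \<open>N\<close>: roots \<open>r\<close> of the small sets \<open>\<sigma> r\<close>.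
  The marks \<open>B\<close> record which hubs are adjacent to \<open>v\<close>, and which sets \<open>\<sigma> r\<close> of size two,
  read as edges, have been added.
\<close>
definition restore ::
  "'a set set \<Rightarrow> 'a \<Rightarrow> 'a set \<Rightarrow> 'a set \<Rightarrow> 'a set \<Rightarrow> 'a set \<Rightarrow> ('a \<Rightarrow> 'a set) \<Rightarrow> ('a \<Rightarrow> 'a) \<Rightarrow> 'a set set"
where
  "restore E v W Y N B \<sigma> \<omega> = (E - \<sigma> ` (N \<inter> B)) \<union> {{v, y} | y. y \<in> Y} \<union> {{\<omega> y, y} | y. y \<in> Y}
     \<union> {{v, w} | w. w \<in> W \<inter> B} \<union> {{v, u} | r u. r \<in> N \<and> u \<in> \<sigma> r}"

locale vertex_in_graph =
  fixes V :: "'a set" and E :: "'a set set" and v :: 'a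
  assumes finite_V: "finite V"
    and edges: "\<And>e. e \<in> E \<Longrightarrow> e \<subseteq> V \<and> card e = 2"
    and nlc: "no_long_cycle E"
    and v_in: "v \<in> V"
begin

definition nbrs where "nbrs = {u. {v, u} \<in> E}"
definition E' where "E' = {e \<in> E. v \<notin> e}"
text \<open>The argument may be any vertex, for instance a hub that is not a neighbour of
  \<open>v\<close>.\<close>

definition cls where "cls x = nbrs \<inter> {y. (x, y) \<in> (adj E')\<^sup>*}"
text \<open>The negation is what \<open>exists_separating_hub\<close> requires of the set: at least
  three vertices, and no triangle in the case of three.\<close>

definition small where
  "small u \<longleftrightarrow> card (cls u) \<le> 2 \<or>
     card (cls u) = 3 \<and> (\<forall>x\<in>cls u. \<forall>y\<in>cls u. x \<noteq> y \<longrightarrow> {x, y} \<in> E')"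
definition is_hub where
  "is_hub Q w \<longleftrightarrow> (\<forall>y\<in>Q - {w}. {w, y} \<in> E') \<and>
    (\<forall>x\<in>insert w Q. \<forall>y\<in>insert w Q. x \<noteq> y \<longrightarrow>
      (x, y) \<notin> (adj (E' - {{w, y} | y. y \<in> Q - {w}}))\<^sup>*)"
text \<open>The value depends on \<open>u\<close> only through \<open>cls u\<close>, so a whole
  class shares its hub. The same device is used for \<open>root\<close>.\<close>

definition hub where "hub u = (SOME w. is_hub (cls u) w)"
definition split_nbrs where "split_nbrs = {u \<in> nbrs. \<not> small u \<and> u \<noteq> hub u}"
definition E1 where "E1 = E' - {{hub y, y} | y. y \<in> split_nbrs}"
definition pairs where "pairs = {cls u | u. u \<in> nbrs \<and> small u \<and> card (cls u) = 2}"
definition E0 where "E0 = E1 \<union> pairs"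
definition is_root where "is_root Q r \<longleftrightarrow> r \<in> Q \<and> Q \<subseteq> insert r (later_nbrs V E0 r)"
definition root where "root u = (SOME r. is_root (cls u) r)"
definition roots where "roots = root ` {u \<in> nbrs. small u}"
definition hubs where "hubs = hub ` split_nbrs"
definition marked where
  "marked = {w \<in> hubs. w \<in> nbrs} \<union> {r \<in> roots. card (cls r) = 2 \<and> cls r \<notin> E}"

section \<open>Components of the graph without the vertex\<close>

lemma nbrs_subset: "nbrs \<subseteq> V" and v_notin_nbrs: "v \<notin> nbrs"
  using edges by (auto simp: nbrs_def dest: edges)

lemma finite_nbrs: "finite nbrs"
  using nbrs_subset finite_V by (rule finite_subset)

lemma E'_subset: "E' \<subseteq> E" by (auto simp: E'_def)

lemma E1_subset: "E1 \<subseteq> E'" by (auto simp: E1_def)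

lemma cls_subset: "cls u \<subseteq> nbrs" by (auto simp: cls_def)

lemma finite_cls: "finite (cls u)"
  using cls_subset finite_nbrs by (rule finite_subset)

lemma self_in_cls: "u \<in> nbrs \<Longrightarrow> u \<in> cls u" by (auto simp: cls_def)

lemma cls_eq: "(x, y) \<in> (adj E')\<^sup>* \<Longrightarrow> cls x = cls y"
  unfolding cls_def by (auto dest: conn_sym intro: rtrancl_trans)

lemma cls_cong:
  assumes "cls x = cls y"
  shows "small x = small y" "hub x = hub y" "root x = root y"
  using assms by (simp_all add: small_def hub_def root_def)

lemma cls_eq_of_mem: "x \<in> cls u \<Longrightarrow> cls x = cls u"
  using cls_eq by (auto simp: cls_def)

lemma conn_if_mem_cls: "x \<in> cls u \<Longrightarrow> y \<in> cls u \<Longrightarrow> (x, y) \<in> (adj E')\<^sup>*"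
  unfolding cls_def by (auto dest: conn_sym intro: rtrancl_trans)

lemma not_conn_v: "(v, x) \<in> (adj E')\<^sup>* \<Longrightarrow> x = v"
  by (erule converse_rtranclE) (auto simp: adj_def E'_def)

lemma short_path:
  assumes "gpath E' xs" "hd xs \<in> nbrs" "last xs \<in> nbrs" "hd xs \<noteq> last xs"
  shows "length xs \<le> 3"
proof (rule cycle_through_vertex[OF nlc])
  show "gpath E xs" using assms(1) E'_subset by (rule gpath_mono)
  have "set xs \<subseteq> - {v}"
    by (rule gpath_closed[OF assms(1)]) (use assms v_notin_nbrs in \<open>auto simp: E'_def\<close>)
  then show "v \<notin> set xs" by blast
qed (use assms in \<open>auto simp: nbrs_def\<close>)

lemma hub:
  assumes "u \<in> nbrs" "\<not> small u"
  shows "is_hub (cls u) (hub u)"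
proof -
  have "\<exists>w. is_hub (cls u) w"
    unfolding is_hub_def
  proof (rule exists_separating_hub)
    show "3 \<le> card (cls u)" using assms by (auto simp: small_def)
    show "(x, y) \<in> (adj E')\<^sup>*" if "x \<in> cls u" "y \<in> cls u" for x y
      using that by (rule conn_if_mem_cls)
    show "length xs \<le> 3"
      if "gpath E' xs" "hd xs \<in> cls u" "last xs \<in> cls u" "hd xs \<noteq> last xs" for xs
      using short_path that cls_subset by blast
    show "\<exists>x\<in>cls u. \<exists>y\<in>cls u. x \<noteq> y \<and> {x, y} \<notin> E'" if "card (cls u) = 3"
      using assms that by (auto simp: small_def)
    show "card e = 2" if "e \<in> E'" for e using that edges E'_subset by blast
  qed
  then show ?thesis unfolding hub_def by (rule someI_ex)
qed

lemma hub_edge: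
  assumes "u \<in> nbrs" "\<not> small u" "y \<in> cls u" "y \<noteq> hub u"
  shows "{hub u, y} \<in> E'"
  using hub[OF assms(1,2)] assms(3,4) by (auto simp: is_hub_def)

lemma conn_hub:
  assumes "u \<in> nbrs" "\<not> small u"
  shows "(u, hub u) \<in> (adj E')\<^sup>*"
  using hub_edge[OF assms self_in_cls[OF assms(1)]]
  by (cases "u = hub u") (auto simp: adj_def insert_commute)

lemma split_nbrsD: "y \<in> split_nbrs \<Longrightarrow> y \<in> nbrs \<and> \<not> small y \<and> y \<noteq> hub y \<and> {hub y, y} \<in> E'"
  using hub_edge self_in_cls by (auto simp: split_nbrs_def)

text \<open>An added pair lies within one component of \<open>E'\<close>, so adding the pairs merges
  no components.\<close>

lemma conn_E0: 
  assumes "(x, y) \<in> (adj E0)\<^sup>*" shows "(x, y) \<in> (adj E')\<^sup>*"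
proof -
  have "adj E0 \<subseteq> (adj E')\<^sup>*"
  proof
    fix z assume "z \<in> adj E0"
    then obtain x y where z: "z = (x, y)" and "{x, y} \<in> E0" by (auto simp: adj_def)
    then consider "{x, y} \<in> E1" | u where "{x, y} = cls u" by (auto simp: E0_def pairs_def)
    then show "z \<in> (adj E')\<^sup>*"
    proof cases
      case 1
      then show ?thesis using E1_subset z by (auto simp: adj_def)
    next
      case 2
      then have "x \<in> cls u" "y \<in> cls u" by blast+
      then show ?thesis using conn_if_mem_cls z by blast
    qed
  qed
  then show ?thesis using assms by (meson rtrancl_subset_rtrancl subsetD)
qed

text \<open>The component of a \<open>u\<close> that is not small contains no added pair, and all
  edges from its hub to \<open>cls u\<close> are gone. So inside it \<open>E0\<close> is contained
  in the graph for which \<open>is_hub\<close> asserts separation.\<close>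

lemma conn_E0_split:
  assumes "(x, y) \<in> (adj E0)\<^sup>*" "u \<in> nbrs" "\<not> small u" "(u, x) \<in> (adj E')\<^sup>*"
  shows "(x, y) \<in> (adj (E' - {{hub u, y} | y. y \<in> cls u - {hub u}}))\<^sup>*"
  using assms(1)
proof (induction rule: rtrancl_induct)
  case (step y z)
  have uy: "(u, y) \<in> (adj E')\<^sup>*" using assms(4) conn_E0[OF step(1)] by (rule rtrancl_trans)
  have "{y, z} \<in> E0" using step(2) by (simp add: adj_def)
  moreover have "{y, z} \<notin> pairs"
  proof
    assume "{y, z} \<in> pairs"
    then obtain u' where u': "{y, z} = cls u'" "small u'" by (auto simp: pairs_def)
    then have "y \<in> cls u'" by blast
    then have "cls u = cls u'" using cls_eq_of_mem[of y u'] cls_eq[OF uy] by simp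
    then show False using u'(2) assms(3) cls_cong(1) by blast
  qed
  ultimately have E1: "{y, z} \<in> E1" by (simp add: E0_def)
  have "{hub u, y'} \<notin> E1" if "y' \<in> cls u - {hub u}" for y'
  proof -
    have "cls y' = cls u" using that cls_eq_of_mem by blast
    then have "hub y' = hub u" "\<not> small y'" using cls_cong assms(3) by metis+
    moreover have "y' \<in> nbrs" using that cls_subset by blast
    ultimately have "y' \<in> split_nbrs" using that by (simp add: split_nbrs_def)
    then have "{hub y', y'} \<notin> E1" unfolding E1_def by blast
    then show ?thesis using \<open>hub y' = hub u\<close> by simp
  qed
  then have "{y, z} \<in> E' - {{hub u, y} | y. y \<in> cls u - {hub u}}"
    using E1 E1_subset by (smt (verit) DiffI mem_Collect_eq subsetD)
  then show ?case using step(3) by (auto simp: adj_def intro: rtrancl.rtrancl_into_rtrancl)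
qed simp

text \<open>The pairs are added one at a time. A cycle through a new pair leaves a path between its
  two ends, inside one component. No other pair lies in this component, so the path is in
  \<open>E'\<close> and has at most three vertices by \<open>short_path\<close>.\<close>

lemma no_long_cycle_E0: "no_long_cycle E0"
proof -
  have "finite pairs" using finite_nbrs by (auto simp: pairs_def)
  moreover have "no_long_cycle (E1 \<union> A)" if "finite A" "A \<subseteq> pairs" for A
    using that
  proof (induction rule: finite_induct)
    case empty
    show ?case using nlc E1_subset E'_subset by (auto intro: no_long_cycle_mono)
  next
    case (insert Q A)
    then obtain u where u: "u \<in> nbrs" "small u" "Q = cls u" "card Q = 2" by (auto simp: pairs_def)
    then obtain a b where ab: "Q = {a, b}" "a \<noteq> b" by (meson card_2_iff)
    show ?case
      unfolding no_long_cycle_def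
    proof (intro allI impI)
      fix xs assume "gcycle (E1 \<union> insert Q A) xs"
      then have "gcycle (insert {a, b} (E1 \<union> A)) xs" using ab by simp
      then show "length xs < 5"
      proof (cases rule: gcycle_insert_cases)
        case 1
        then show ?thesis using insert by (auto simp: no_long_cycle_def)
      next
        case (2 ys)
        have sub: "E1 \<union> A \<subseteq> E0" using insert.prems by (auto simp: E0_def)
        have "{hd ys, last ys} = Q" using 2(2) ab by simp
        then have hq: "hd ys \<in> Q" "last ys \<in> Q" "hd ys \<noteq> last ys"
          using u(4) by (blast, blast, auto)
        have "gpath E' ys"
        proof -
          have "successively (\<lambda>x y. {x, y} \<in> E') ys"
            unfolding successively_conv_nth
          proof (intro allI impI)
            fix i assume i: "Suc i < length ys"
            let ?x = "ys ! i" and ?y = "ys ! Suc i"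
            have e: "{?x, ?y} \<in> E1 \<union> A" using 2(1) i by (auto simp: gpath_def successively_conv_nth)
            have "(hd ys, ?x) \<in> (adj (E1 \<union> A))\<^sup>*" using conn_if_gpath[OF 2(1)] i by simp
            then have "cls (hd ys) = cls ?x" using sub by (intro cls_eq conn_E0) (rule conn_mono)
            then have c: "cls ?x = Q" using cls_eq_of_mem[of "hd ys" u] hq(1) u(3) by simp
            have "{?x, ?y} \<notin> A"
            proof
              assume "{?x, ?y} \<in> A"
              then obtain u' where "{?x, ?y} = cls u'" using insert.prems by (auto simp: pairs_def)
              moreover from this have "cls ?x = cls u'" by (intro cls_eq_of_mem) blast
              ultimately show False using c \<open>{?x, ?y} \<in> A\<close> insert.hyps by simp
            qed
            then show "{?x, ?y} \<in> E'" using e E1_subset by blast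
          qed
          then show ?thesis using 2(1) by (simp add: gpath_def)
        qed
        then have "length ys \<le> 3" using short_path hq u(3) cls_subset by blast
        then show ?thesis using 2(3) by simp
      qed
    qed
  qed
  ultimately show ?thesis unfolding E0_def by blast
qed

lemma edges_E0: "e \<in> E0 \<Longrightarrow> e \<subseteq> V \<and> card e = 2"
proof -
  assume "e \<in> E0"
  then consider "e \<in> E1" | u where "e = cls u" "card (cls u) = 2" by (auto simp: E0_def pairs_def)
  then show ?thesis
  proof cases
    case 1
    then show ?thesis using E1_subset E'_subset edges by blast
  next
    case 2
    then show ?thesis using cls_subset[of u] nbrs_subset by simp
  qed
qed

text \<open>A small class is a clique of \<open>E0\<close>: a class of size two has been added as an
  edge, and a triangle keeps its edges because deleted hub edges end in classes that are not
  small.\<close>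

lemma is_root:
  assumes "u \<in> nbrs" "small u"
  shows "is_root (cls u) (root u)"
proof -
  have "\<exists>r\<in>cls u. cls u \<subseteq> insert r (later_nbrs V E0 r)"
  proof (rule clique_subset_later_nbrs[OF finite_V edges_E0 no_long_cycle_E0])
    show "cls u \<subseteq> V" "cls u \<noteq> {}" using cls_subset[of u] nbrs_subset self_in_cls[OF assms(1)] by auto
    fix x y assume xy: "x \<in> cls u" "y \<in> cls u" "x \<noteq> y"
    show "{x, y} \<in> E0"
    proof (cases "card (cls u) \<le> 2")
      case True
      have "{x, y} \<subseteq> cls u" "card {x, y} = 2" using xy by auto
      then have "cls u = {x, y}" using True finite_cls by (metis card_seteq)
      then have "{x, y} \<in> pairs" using assms xy unfolding pairs_def by force
      then show ?thesis by (simp add: E0_def)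
    next
      case False
      then have "{x, y} \<in> E'" using assms xy by (auto simp: small_def)
      moreover have "{x, y} \<noteq> {hub z, z}" if "z \<in> split_nbrs" for z
      proof
        assume "{x, y} = {hub z, z}"
        then have "z \<in> {x, y}" by simp
        then have "z \<in> cls u" using xy by blast
        then have "small z" using cls_eq_of_mem cls_cong(1) assms(2) by blast
        then show False using that by (simp add: split_nbrs_def)
      qed
      ultimately show ?thesis by (auto simp: E0_def E1_def)
    qed
  qed
  then have "\<exists>r. is_root (cls u) r" by (auto simp: is_root_def)
  then show ?thesis unfolding root_def by (rule someI_ex)
qed

section \<open>Separation of the roots\<close>

lemma rootsD:
  assumes "r \<in> roots"
  shows "r \<in> nbrs" "small r" "root r = r" "is_root (cls r) r"
proof -
  obtain u where u: "u \<in> nbrs" "small u" "r = root u" using assms by (auto simp: roots_def)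
  then have "r \<in> cls u" using is_root by (auto simp: is_root_def)
  then have c: "cls r = cls u" by (rule cls_eq_of_mem)
  show "r \<in> nbrs" using \<open>r \<in> cls u\<close> cls_subset by blast
  show "small r" "root r = r" "is_root (cls r) r"
    using cls_cong[OF c] u is_root[OF u(1,2)] c by metis+
qed

lemma hubsE:
  assumes "w \<in> hubs"
  obtains u where "u \<in> nbrs" "\<not> small u" "u \<noteq> hub u" "w = hub u" "(u, w) \<in> (adj E')\<^sup>*"
  using assms conn_hub by (auto simp: hubs_def split_nbrs_def)

lemma hub_of_hub_nbr:
  assumes "w \<in> hubs" "w \<in> nbrs"
  shows "\<not> small w \<and> hub w = w"
proof -
  obtain u where u: "u \<in> nbrs" "\<not> small u" "w = hub u" "(u, w) \<in> (adj E')\<^sup>*"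
    using assms(1) by (rule hubsE)
  have "small w = small u" "hub w = hub u" using cls_cong[OF cls_eq[OF u(4)]] by auto
  then show ?thesis using u(2,3) by metis
qed

lemma disjoint_roots:
  "hubs \<inter> split_nbrs = {}" "hubs \<inter> roots = {}" "split_nbrs \<inter> roots = {}"
  "v \<notin> hubs" "v \<notin> split_nbrs" "v \<notin> roots"
proof -
  show "hubs \<inter> split_nbrs = {}" using hub_of_hub_nbr by (force simp: split_nbrs_def)
  show "hubs \<inter> roots = {}" using hub_of_hub_nbr rootsD(1,2) by blast
  show "split_nbrs \<inter> roots = {}" using rootsD(2) by (auto simp: split_nbrs_def)
  show "v \<notin> hubs"
  proof
    assume "v \<in> hubs"
    then obtain u where "u \<in> nbrs" "(u, v) \<in> (adj E')\<^sup>*" by (rule hubsE)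
    then show False using not_conn_v[OF conn_sym] v_notin_nbrs by blast
  qed
  show "v \<notin> split_nbrs" "v \<notin> roots" using v_notin_nbrs rootsD(1) by (auto simp: split_nbrs_def)
qed

lemma all_roots_subset: "insert v (hubs \<union> split_nbrs \<union> roots) \<subseteq> V"
proof -
  have "hub y \<in> V" if "y \<in> split_nbrs" for y
    using split_nbrsD[OF that] E'_subset edges[of "{hub y, y}"] by blast
  then have "hubs \<subseteq> V" by (auto simp: hubs_def)
  moreover have "roots \<subseteq> nbrs" using rootsD(1) by blast
  moreover have "split_nbrs \<subseteq> nbrs" by (auto simp: split_nbrs_def)
  ultimately show ?thesis using nbrs_subset v_in by blast
qed

text \<open>A common description of the three kinds of roots, which lets their separation be proved
  without distinguishing pairs of kinds.\<close>

lemma root_anchor: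
  assumes "x \<in> hubs \<union> split_nbrs \<union> roots"
  obtains u where "u \<in> nbrs" "(u, x) \<in> (adj E')\<^sup>*" "small u \<longrightarrow> x = root u"
    "\<not> small u \<longrightarrow> x \<in> insert (hub u) (cls u)"
proof -
  consider "x \<in> hubs" | "x \<in> split_nbrs" | "x \<in> roots" using assms by blast
  then show ?thesis
  proof cases
    case 1
    then show ?thesis by (rule hubsE) (use that in blast)
  next
    case 2
    then show ?thesis using that[of x] self_in_cls by (auto simp: split_nbrs_def)
  next
    case 3
    then show ?thesis using that[of x] rootsD by simp
  qed
qed

text \<open>Different components of \<open>E'\<close> stay apart, and \<open>v\<close> is isolated.
  A component with a small class has a single root; in any other the hub property separates the
  roots.\<close>

lemma roots_separated:
  assumes "x \<in> insert v (hubs \<union> split_nbrs \<union> roots)" "y \<in> insert v (hubs \<union> split_nbrs \<union> roots)" "x \<noteq> y"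
  shows "(x, y) \<notin> (adj E0)\<^sup>*"
proof
  assume c0: "(x, y) \<in> (adj E0)\<^sup>*"
  then have c: "(x, y) \<in> (adj E')\<^sup>*" by (rule conn_E0)
  then have "x \<noteq> v" "y \<noteq> v" using not_conn_v[of x] not_conn_v[of y] conn_sym[OF c] assms(3) by blast+
  then have x: "x \<in> hubs \<union> split_nbrs \<union> roots" and y: "y \<in> hubs \<union> split_nbrs \<union> roots"
    using assms by auto
  obtain a where a: "a \<in> nbrs" "(a, x) \<in> (adj E')\<^sup>*" "small a \<longrightarrow> x = root a"
    "\<not> small a \<longrightarrow> x \<in> insert (hub a) (cls a)" by (rule root_anchor[OF x])
  obtain b where b: "b \<in> nbrs" "(b, y) \<in> (adj E')\<^sup>*" "small b \<longrightarrow> y = root b"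
    "\<not> small b \<longrightarrow> y \<in> insert (hub b) (cls b)" by (rule root_anchor[OF y])
  have ab: "cls a = cls b" using cls_eq[OF a(2)] cls_eq[OF b(2)] cls_eq[OF c] by simp
  show False
  proof (cases "small a")
    case True
    then show False using a b cls_cong[OF ab] assms(3) by simp
  next
    case False
    then have "y \<in> insert (hub a) (cls a)" using b(4) cls_cong[OF ab] ab by simp
    then show False
      using hub[OF a(1) False] a(4) False conn_E0_split[OF c0 a(1) False a(2)] assms(3)
      unfolding is_hub_def by blast
  qed
qed

text \<open>The only edges of \<open>E0\<close> outside \<open>E\<close> are added pairs, and their
  roots are marked. Conversely, an edge avoiding \<open>v\<close> survives or is a hub edge, and an
  edge at \<open>v\<close> leads to a small class, a split neighbour or a hub.\<close>

lemma restore_E0: "restore E0 v hubs split_nbrs roots marked cls hub = E"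
proof (intro equalityI subsetI)
  fix e assume "e \<in> restore E0 v hubs split_nbrs roots marked cls hub"
  then consider "e \<in> E0" "e \<notin> cls ` (roots \<inter> marked)" | y where "e = {v, y}" "y \<in> split_nbrs"
    | y where "e = {hub y, y}" "y \<in> split_nbrs" | w where "e = {v, w}" "w \<in> hubs \<inter> marked"
    | r u where "e = {v, u}" "r \<in> roots" "u \<in> cls r"
    unfolding restore_def by blast
  then show "e \<in> E"
  proof cases
    case 1
    show ?thesis
    proof (rule ccontr)
      assume "e \<notin> E"
      then obtain u where u: "e = cls u" "u \<in> nbrs" "small u" "card (cls u) = 2"
        using 1(1) E1_subset E'_subset by (auto simp: E0_def pairs_def)
      have "root u \<in> cls u" using is_root[OF u(2,3)] by (simp add: is_root_def)
      then have "cls (root u) = e" using cls_eq_of_mem u by simp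
      then show False using 1(2) u \<open>e \<notin> E\<close> by (auto simp: marked_def roots_def)
    qed
  next
    case 2 then show ?thesis by (auto simp: split_nbrs_def nbrs_def)
  next
    case 3 then show ?thesis using split_nbrsD E'_subset by blast
  next
    case 4
    then have "w \<in> nbrs" using disjoint_roots by (auto simp: marked_def)
    then show ?thesis using 4 by (simp add: nbrs_def)
  next
    case 5 then show ?thesis using cls_subset by (auto simp: nbrs_def)
  qed
next
  fix e assume e: "e \<in> E"
  show "e \<in> restore E0 v hubs split_nbrs roots marked cls hub"
  proof (cases "v \<in> e")
    case True
    obtain a b where "e = {a, b}" using edges[OF e] by (meson card_2_iff)
    then obtain u where u: "e = {v, u}" using True by blast
    then have n: "u \<in> nbrs" using e by (simp add: nbrs_def)
    consider "small u" | "u \<in> split_nbrs" | "\<not> small u" "u = hub u" using n by (auto simp: split_nbrs_def)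
    then show ?thesis
    proof cases
      case 1
      have "root u \<in> cls u" using is_root[OF n 1] by (simp add: is_root_def)
      then have "cls (root u) = cls u" by (rule cls_eq_of_mem)
      then have "u \<in> cls (root u)" "root u \<in> roots" using self_in_cls[OF n] n 1 by (auto simp: roots_def)
      then show ?thesis using u unfolding restore_def by blast
    next
      case 2
      then show ?thesis using u unfolding restore_def by blast
    next
      case 3
      \<comment> \<open>To be in \<open>hubs\<close>, \<open>u\<close> needs a neighbour split from
        it. Its class is not small and so provides one.\<close>
      have "\<not> cls u \<subseteq> {u}"
      proof
        assume "cls u \<subseteq> {u}"
        then have "card (cls u) \<le> card {u}" by (intro card_mono) auto
        then show False using 3(1) by (simp add: small_def)
      qed
      then obtain y where y: "y \<in> cls u" "y \<noteq> u" by blast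
      have "cls y = cls u" using y by (intro cls_eq_of_mem)
      then have "hub y = u" "y \<in> split_nbrs"
        using cls_cong[of y u] 3 y cls_subset by (auto simp: split_nbrs_def)
      then have "u \<in> hubs" unfolding hubs_def by blast
      then have "u \<in> hubs \<inter> marked" using n by (simp add: marked_def)
      then show ?thesis using u unfolding restore_def by blast
    qed
  next
    case False
    then have "e \<in> E'" using e by (simp add: E'_def)
    show ?thesis
    proof (cases "e \<in> E1")
      case True
      have "e \<notin> cls ` (roots \<inter> marked)"
        using e disjoint_roots by (auto simp: marked_def)
      then show ?thesis using True unfolding restore_def E0_def by blast
    next
      case False
      then obtain y where "e = {hub y, y}" "y \<in> split_nbrs" using \<open>e \<in> E'\<close> by (auto simp: E1_def)
      then show ?thesis unfolding restore_def by blast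
    qed
  qed
qed

text \<open>For the last bound, \<open>restore_E0\<close> shows that every neighbour is split, a
  hub, or in one of the small sets, which have at most three elements.\<close>

lemma card_bounds:
  "card hubs \<le> card split_nbrs" "card split_nbrs + card roots \<le> card nbrs"
  "card nbrs \<le> card split_nbrs + card hubs + 3 * card roots"
proof -
  have fs: "finite split_nbrs" "finite roots" "finite hubs"
    using finite_nbrs by (auto simp: split_nbrs_def roots_def hubs_def)
  show "card hubs \<le> card split_nbrs" unfolding hubs_def using fs by (intro card_image_le)
  have "card split_nbrs + card roots = card (split_nbrs \<union> roots)"
    using fs disjoint_roots by (simp add: card_Un_disjoint)
  also have "\<dots> \<le> card nbrs"
    using rootsD(1) by (intro card_mono[OF finite_nbrs]) (auto simp: split_nbrs_def)
  finally show "card split_nbrs + card roots \<le> card nbrs" .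
  have "nbrs \<subseteq> (split_nbrs \<union> hubs) \<union> (\<Union>r\<in>roots. cls r)"
  proof
    fix u assume n: "u \<in> nbrs"
    then have "{v, u} \<in> restore E0 v hubs split_nbrs roots marked cls hub"
      by (simp add: restore_E0 nbrs_def)
    moreover have "{v, u} \<notin> E0"
    proof
      assume "{v, u} \<in> E0"
      then have "(v, u) \<in> (adj E0)\<^sup>*" by (auto simp: adj_def)
      then show False using conn_E0 not_conn_v n v_notin_nbrs by blast
    qed
    moreover have "{v, u} \<noteq> {hub y, y}" if "y \<in> split_nbrs" for y
      using split_nbrsD[OF that] by (force simp: E'_def)
    ultimately show "u \<in> (split_nbrs \<union> hubs) \<union> (\<Union>r\<in>roots. cls r)"
      unfolding restore_def by (auto simp: doubleton_eq_iff)
  qed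
  then have "card nbrs \<le> card ((split_nbrs \<union> hubs) \<union> (\<Union>r\<in>roots. cls r))"
    using fs finite_cls by (intro card_mono) auto
  also have "\<dots> \<le> card (split_nbrs \<union> hubs) + card (\<Union>r\<in>roots. cls r)" by (rule card_Un_le)
  also have "\<dots> \<le> (card split_nbrs + card hubs) + (\<Sum>r\<in>roots. card (cls r))"
    using fs by (intro add_mono card_Un_le card_UN_le)
  also have "(\<Sum>r\<in>roots. card (cls r)) \<le> (\<Sum>r\<in>roots. 3)"
    using rootsD(2) by (intro sum_mono) (force simp: small_def)
  finally show "card nbrs \<le> card split_nbrs + card hubs + 3 * card roots" by simp
qed

text \<open>Summary of the construction for the counting, which needs only these properties of the
  pieces.\<close>

lemma dismantle:
  "\<exists>E0 W Y N B \<sigma> \<omega>. (\<forall>e\<in>E0. e \<subseteq> V \<and> card e = 2) \<and> no_long_cycle E0 \<and>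
     insert v (W \<union> Y \<union> N) \<subseteq> V \<and> B \<subseteq> W \<union> N \<and>
     card (insert v (W \<union> Y \<union> N)) = Suc (card Y + card W + card N) \<and>
     (\<forall>x\<in>insert v (W \<union> Y \<union> N). \<forall>y\<in>insert v (W \<union> Y \<union> N). x \<noteq> y \<longrightarrow> (x, y) \<notin> (adj E0)\<^sup>*) \<and>
     restore E0 v W Y N B \<sigma> \<omega> = E \<and>
     (\<forall>r\<in>N. \<sigma> r \<subseteq> insert r (later_nbrs V E0 r)) \<and> \<omega> ` Y \<subseteq> W \<and>
     card W \<le> card Y \<and> card Y + card N \<le> card nbrs \<and> card nbrs \<le> card Y + card W + 3 * card N"
proof -
  have "finite split_nbrs" "finite roots" "finite hubs"
    using finite_nbrs by (auto simp: split_nbrs_def roots_def hubs_def)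
  then have card_all: "card (insert v (hubs \<union> split_nbrs \<union> roots)) = Suc (card split_nbrs + card hubs + card roots)"
    using disjoint_roots by (simp add: card_Un_disjoint Int_Un_distrib2)
  show ?thesis
  proof (rule exI[of _ E0], rule exI[of _ hubs], rule exI[of _ split_nbrs], rule exI[of _ roots],
      rule exI[of _ marked], rule exI[of _ cls], rule exI[of _ hub], intro conjI)
    show "\<forall>e\<in>E0. e \<subseteq> V \<and> card e = 2" using edges_E0 by blast
    show "marked \<subseteq> hubs \<union> roots" by (auto simp: marked_def)
    show "\<forall>x\<in>insert v (hubs \<union> split_nbrs \<union> roots). \<forall>y\<in>insert v (hubs \<union> split_nbrs \<union> roots).
        x \<noteq> y \<longrightarrow> (x, y) \<notin> (adj E0)\<^sup>*" using roots_separated by blast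
    show "\<forall>r\<in>roots. cls r \<subseteq> insert r (later_nbrs V E0 r)" using rootsD(4) by (simp add: is_root_def)
    show "hub ` split_nbrs \<subseteq> hubs" by (simp add: hubs_def)
  qed (use no_long_cycle_E0 all_roots_subset restore_E0 card_bounds card_all in simp_all)
qed

end

section \<open>Reattaching the pieces\<close>

definition und :: "('a \<times> 'a) set \<Rightarrow> 'a set set" where
  "und F = (\<lambda>(x, y). {x, y}) ` F"

text \<open>Every term of the tail is at most \<open>c i\<close> and every earlier term at least
  \<open>c i\<close>, so the average of the tail does not exceed the average of all
  \<open>p + 1\<close> terms.\<close>

lemma antimono_tail_sum_le:
  fixes c :: "nat \<Rightarrow> nat"
  assumes anti: "\<And>i j. i \<le> j \<Longrightarrow> j \<le> p \<Longrightarrow> c j \<le> c i" and i: "i \<le> p"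
  shows "(p + 1) * (\<Sum>j=i..p. c j) \<le> (p + 1 - i) * (\<Sum>j=0..p. c j)"
proof -
  let ?S = "\<Sum>j=i..p. c j" and ?L = "\<Sum>j=0..<i. c j"
  have split: "(\<Sum>j=0..p. c j) = ?L + ?S"
    using i by (metis atLeastLessThanSuc_atLeastAtMost le_SucI sum.atLeastLessThan_concat zero_le)
  have "?S \<le> (\<Sum>j=i..p. c i)" using anti by (intro sum_mono) auto
  then have S: "?S \<le> (p + 1 - i) * c i" by simp
  have "(\<Sum>j=0..<i. c i) \<le> ?L" using anti i by (intro sum_mono) auto
  then have L: "i * c i \<le> ?L" by simp
  have "(p + 1) * ?S = (p + 1 - i) * ?S + i * ?S" using i by (simp flip: add_mult_distrib)
  also have "i * ?S \<le> i * ((p + 1 - i) * c i)" using S by (rule mult_le_mono2)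
  also have "\<dots> = (p + 1 - i) * (i * c i)" by simp
  also have "\<dots> \<le> (p + 1 - i) * ?L" using L by (rule mult_le_mono2)
  finally show ?thesis unfolding split by (simp add: distrib_left)
qed

lemma exists_antimono_enumeration:
  fixes c :: "'a \<Rightarrow> nat"
  assumes "finite R"
  obtains e where "bij_betw e {..<card R} R" "\<And>i j. i \<le> j \<Longrightarrow> j < card R \<Longrightarrow> c (e j) \<le> c (e i)"
proof -
  obtain xs where xs: "set xs = R" "distinct xs" using assms finite_distinct_list by blast
  define rs where "rs = sort_key c xs"
  have rs: "set rs = R" "distinct rs" "length rs = card R" "sorted (map c rs)"
    using xs by (auto simp: rs_def distinct_card)
  define qs where "qs = rev rs"
  have "bij_betw ((!) qs) {..<card R} R"
    using rs by (intro bij_betw_nth) (auto simp: qs_def)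
  moreover have "c (qs ! j) \<le> c (qs ! i)" if "i \<le> j" "j < card R" for i j
  proof -
    have "map c rs ! (card R - Suc j) \<le> map c rs ! (card R - Suc i)"
      using rs that by (intro sorted_nth_mono) auto
    then show ?thesis using that rs by (simp add: qs_def rev_nth)
  qed
  ultimately show ?thesis using that by blast
qed

lemma rtrancl_closed:
  assumes "(x, y) \<in> (adj E)\<^sup>*" "x \<in> A" "\<And>x y. x \<in> A \<Longrightarrow> {x, y} \<in> E \<Longrightarrow> y \<in> A"
  shows "y \<in> A"
  using assms(1,2) by (induction rule: rtrancl_induct) (auto simp: adj_def intro: assms(3))

text \<open>The roots are listed as \<open>e 0\<close>, ..., \<open>e p\<close> by decreasing size
  of their components, and \<open>e i\<close> is joined to any vertex outside the components of
  \<open>e i\<close>, ..., \<open>e p\<close>. By averaging, at least a fraction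
  \<open>i / (p + 1)\<close> of all vertices is available; the product over \<open>i\<close> is the
  bound. Nothing attaches \<open>e 0\<close>, which is the exceptional root
  \<open>r\<close>.\<close>

lemma exists_many_attachments:
  fixes V :: "'a set"
  assumes V: "finite V" and E: "\<And>e. e \<in> E \<Longrightarrow> e \<subseteq> V \<and> card e = 2" and nlc: "no_long_cycle E"
    and R: "R \<subseteq> V" "card R = Suc p"
    and sep: "\<And>x y. x \<in> R \<Longrightarrow> y \<in> R \<Longrightarrow> x \<noteq> y \<Longrightarrow> (x, y) \<notin> (adj E)\<^sup>*"
  shows "\<exists>r\<in>R. \<exists>\<F>. finite \<F> \<and> card V ^ p * fact p \<le> card \<F> * (p + 1) ^ p \<and>
    (\<forall>F\<in>\<F>. card F = p \<and> snd ` F = R - {r} \<and> E \<inter> und F = {} \<and>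
       (\<forall>e\<in>E \<union> und F. e \<subseteq> V \<and> card e = 2) \<and> no_long_cycle (E \<union> und F))"
proof -
  define comp where "comp r = {x. (r, x) \<in> (adj E)\<^sup>*}" for r
  have finR: "finite R" using R V finite_subset by blast
  have comp_closed: "y \<in> comp r" if "x \<in> comp r" "{x, y} \<in> E" for x y r
    using that by (auto simp: comp_def adj_def intro: rtrancl.rtrancl_into_rtrancl)
  have comp_V: "comp r \<subseteq> V" if "r \<in> R" for r
  proof
    fix x assume "x \<in> comp r"
    then have "(r, x) \<in> (adj E)\<^sup>*" by (simp add: comp_def)
    then show "x \<in> V" by (rule rtrancl_closed) (use that R E in blast)+
  qed
  have comp_self: "r \<in> comp r" for r by (simp add: comp_def)
  have comp_disj: "comp x \<inter> comp y = {}" if "x \<in> R" "y \<in> R" "x \<noteq> y" for x y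
  proof (rule ccontr)
    assume "comp x \<inter> comp y \<noteq> {}"
    then obtain z where "(x, z) \<in> (adj E)\<^sup>*" "(y, z) \<in> (adj E)\<^sup>*" by (auto simp: comp_def)
    then have "(x, y) \<in> (adj E)\<^sup>*" using conn_sym rtrancl_trans by metis
    then show False using sep that by blast
  qed
  obtain e where e: "bij_betw e {..<card R} R"
    and anti: "\<And>i j. i \<le> j \<Longrightarrow> j < card R \<Longrightarrow> card (comp (e j)) \<le> card (comp (e i))"
    using exists_antimono_enumeration[OF finR, of "\<lambda>r. card (comp r)"] by metis
  have eR: "e i \<in> R" if "i \<le> p" for i using e that R by (auto simp: bij_betw_def)
  have e_inj: "e i = e j \<longleftrightarrow> i = j" if "i \<le> p" "j \<le> p" for i j
    using e that R(2) inj_on_eq_iff[of e "{..<card R}" i j] by (auto simp: bij_betw_def)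
  define U where "U i = (\<Union>j\<in>{i..p}. comp (e j))" for i
  define T where "T i = V - U i" for i
  have U_V: "U i \<subseteq> V" for i unfolding U_def using comp_V[OF eR] by (intro UN_least) auto
  have cardU: "card (U i) = (\<Sum>j=i..p. card (comp (e j)))" for i
    unfolding U_def
  proof (rule card_UN_disjoint)
    show "\<forall>j\<in>{i..p}. finite (comp (e j))" using comp_V eR V finite_subset by (metis atLeastAtMost_iff)
    show "\<forall>j\<in>{i..p}. \<forall>k\<in>{i..p}. j \<noteq> k \<longrightarrow> comp (e j) \<inter> comp (e k) = {}"
      using comp_disj eR e_inj by auto
  qed simp
  have cardT: "i * card V \<le> (p + 1) * card (T i)" if i: "i \<le> p" for i
  proof -
    have "(p + 1) * card (U i) \<le> (p + 1 - i) * card (U 0)"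
      unfolding cardU using anti i R(2) by (intro antimono_tail_sum_le) auto
    also have "\<dots> \<le> (p + 1 - i) * card V" using U_V V by (intro mult_le_mono2 card_mono)
    finally have "(p + 1) * card (U i) + i * card V \<le> (p + 1 - i) * card V + i * card V" by simp
    also have "\<dots> = (p + 1) * card V" using i by (simp flip: add_mult_distrib)
    finally have le: "(p + 1) * card (U i) + i * card V \<le> (p + 1) * card V" .
    have cV: "card V = card (U i) + card (T i)"
      unfolding T_def using U_V V by (metis card_Diff_subset card_mono finite_subset le_add_diff_inverse)
    have "(p + 1) * card V = (p + 1) * card (U i) + (p + 1) * card (T i)"
      unfolding cV by (rule distrib_left)
    then show ?thesis using le by linarith
  qed
  \<comment> \<open>Each arc points to the root of the piece that it attaches, so the arc set
    determines both the attached roots and the map \<open>f\<close>.\<close>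
  define arcs where "arcs f m = (\<lambda>i. (f i, e i)) ` {1..m}" for f :: "nat \<Rightarrow> 'a" and m
  define \<F> where "\<F> = (\<lambda>f. arcs f p) ` Pi\<^sub>E {1..p} T"
  have inj: "inj_on (\<lambda>f. arcs f p) (Pi\<^sub>E {1..p} T)"
  proof (rule inj_onI)
    fix f g assume f: "f \<in> Pi\<^sub>E {1..p} T" and g: "g \<in> Pi\<^sub>E {1..p} T" and eq: "arcs f p = arcs g p"
    show "f = g"
    proof (rule PiE_ext[OF f g])
      fix i assume i: "i \<in> {1..p}"
      then have "(f i, e i) \<in> arcs f p" by (auto simp: arcs_def)
      then have "(f i, e i) \<in> arcs g p" using eq by simp
      then obtain j where "j \<in> {1..p}" "f i = g j" "e i = e j" by (auto simp: arcs_def)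
      then show "f i = g i" using e_inj i by auto
    qed
  qed
  have finT: "finite (T i)" for i using V by (simp add: T_def)
  have "card V ^ p * fact p = (\<Prod>i=1..p. i * card V)"
    by (simp add: prod.distrib fact_prod mult.commute)
  also have "\<dots> \<le> (\<Prod>i=1..p. (p + 1) * card (T i))"
    using cardT by (intro prod_mono) auto
  also have "\<dots> = (\<Prod>i=1..p. card (T i)) * (p + 1) ^ p"
    by (subst prod.distrib) (simp add: mult.commute del: mult_Suc mult_Suc_right)
  also have "(\<Prod>i=1..p. card (T i)) = card \<F>"
    unfolding \<F>_def using inj by (simp add: card_image card_PiE)
  finally have cardF: "card V ^ p * fact p \<le> card \<F> * (p + 1) ^ p" .
  have main: "card F = p \<and> snd ` F = R - {e 0} \<and> E \<inter> und F = {} \<and>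
       (\<forall>e\<in>E \<union> und F. e \<subseteq> V \<and> card e = 2) \<and> no_long_cycle (E \<union> und F)" if "F \<in> \<F>" for F
  proof -
    obtain f where f: "f \<in> Pi\<^sub>E {1..p} T" and F: "F = arcs f p" using \<open>F \<in> \<F>\<close> by (auto simp: \<F>_def)
    have fT: "f i \<in> V" "\<And>j. i \<le> j \<Longrightarrow> j \<le> p \<Longrightarrow> f i \<notin> comp (e j)" if "1 \<le> i" "i \<le> p" for i
      using f that PiE_mem[OF f, of i] by (auto simp: T_def U_def)
    have "inj_on (\<lambda>i. (f i, e i)) {1..p}" using e_inj by (auto simp: inj_on_def)
    then have "card F = p" by (simp add: F arcs_def card_image)
    moreover have "snd ` F = R - {e 0}"
    proof -
      have "snd ` F = e ` {1..p}" by (simp add: F arcs_def image_image)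
      also have "{1..p} = {..<card R} - {0}" using R by auto
      also have "e ` ({..<card R} - {0}) = e ` {..<card R} - e ` {0}"
        using e R by (intro inj_on_image_set_diff[of _ "{..<card R}"]) (auto simp: bij_betw_def)
      finally show ?thesis using e by (simp add: bij_betw_def)
    qed
    moreover have "{f i, e i} \<notin> E" if "1 \<le> i" "i \<le> p" for i
      using fT(2)[OF that, of i] comp_closed[of "e i" "e i" "f i"] comp_self that
      by (auto simp: insert_commute)
    then have "E \<inter> und F = {}" by (auto simp: F arcs_def und_def)
    moreover have "{f i, e i} \<subseteq> V \<and> card {f i, e i} = 2" if "1 \<le> i" "i \<le> p" for i
    proof -
      have "f i \<noteq> e i" using fT(2)[OF that, of i] comp_self[of "e i"] that by auto
      then show ?thesis using fT(1)[OF that] eR[OF that(2)] R(1) by auto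
    qed
    then have "\<forall>e\<in>E \<union> und F. e \<subseteq> V \<and> card e = 2"
      using E by (auto simp: F arcs_def und_def)
    moreover have "no_long_cycle (E \<union> und (arcs f m))" if "m \<le> p" for m
      using that
    proof (induction m)
      case 0
      then show ?case using nlc by (simp add: arcs_def und_def)
    next
      case (Suc m)
      let ?E = "E \<union> und (arcs f m)" and ?a = "e (Suc m)" and ?b = "f (Suc m)"
      \<comment> \<open>All earlier arcs have both ends outside the component of \<open>?a\<close>,
        so this is still a full component and the next edge is a bridge.\<close>
      have closed: "y \<in> comp ?a" if x: "x \<in> comp ?a" and xy: "{x, y} \<in> ?E" for x y
      proof (cases "{x, y} \<in> E")
        case True
        then show ?thesis using comp_closed x by blast
      next
        case False
        then obtain i where i: "1 \<le> i" "i \<le> m" "{x, y} = {f i, e i}"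
          using xy by (auto simp: und_def arcs_def)
        have "f i \<notin> comp ?a" using fT(2)[of i "Suc m"] i Suc.prems by auto
        moreover have "e i \<notin> comp ?a"
          using comp_disj[of "e i" ?a] eR[of i] eR[of "Suc m"] e_inj[of i "Suc m"] i Suc.prems comp_self[of "e i"]
          by auto
        moreover have "x \<in> {f i, e i}" using i(3) by blast
        ultimately show ?thesis using x by blast
      qed
      have "(?a, ?b) \<notin> (adj ?E)\<^sup>*"
      proof
        assume "(?a, ?b) \<in> (adj ?E)\<^sup>*"
        then have "?b \<in> comp ?a" by (rule rtrancl_closed[OF _ comp_self closed])
        then show False using fT(2)[of "Suc m" "Suc m"] Suc.prems by auto
      qed
      then have "no_long_cycle (insert {?a, ?b} ?E)"
        using Suc by (intro no_long_cycle_insert_bridge) auto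
      moreover have "arcs f (Suc m) = insert (?b, ?a) (arcs f m)"
        by (simp add: arcs_def atLeastAtMostSuc_conv)
      ultimately show ?case by (simp add: und_def insert_commute)
    qed
    then have "no_long_cycle (E \<union> und F)" by (simp add: F)
    ultimately show ?thesis by blast
  qed
  have "finite \<F>" unfolding \<F>_def using finT by (intro finite_imageI finite_PiE) auto
  then show ?thesis using cardF main eR[of 0] by (intro bexI[of _ "e 0"] exI[of _ \<F>]) auto
qed

section \<open>Counting\<close>

text \<open>All possible values of the arguments \<open>v, W, Y, N, B, \<sigma>, \<omega>\<close> of \<^const>\<open>restore\<close> with roots in \<open>R\<close>.\<close>
definition codes :: "'a set \<Rightarrow> 'a set set \<Rightarrow> 'a set \<Rightarrow> nat \<Rightarrow> nat \<Rightarrow> _" where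
  "codes V E R a k = (SIGMA v:R. SIGMA W:{W. W \<subseteq> R \<and> card W = k}. SIGMA Y:{Y. Y \<subseteq> R \<and> card Y = a}.
     SIGMA N:Pow R. SIGMA B:Pow R. SIGMA \<sigma>:Pi\<^sub>E R (\<lambda>r. Pow (insert r (later_nbrs V E r))). Pi\<^sub>E Y (\<lambda>_. W))"

text \<open>\<open>E - und F\<close> is the dismantled graph; its roots are the heads of the arcs in
  \<open>F\<close> together with the exceptional root \<open>r\<close>.\<close>

definition rebuilt :: "nat \<Rightarrow> nat \<Rightarrow> nat \<Rightarrow> nat \<Rightarrow> _" where
  "rebuilt n p a k = (SIGMA E:no_long_cycle_edges n. SIGMA F:{F. F \<subseteq> adj E \<and> card F = p}. SIGMA r:{1..n}.
     codes {1..n} (E - und F) (insert r (snd ` F)) a k)"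

definition decode ::
  "'a set set \<times> ('a \<times> 'a) set \<times> 'a \<times> 'a \<times> 'a set \<times> 'a set \<times> 'a set \<times> 'a set \<times> ('a \<Rightarrow> 'a set) \<times> ('a \<Rightarrow> 'a)
     \<Rightarrow> 'a set set \<times> 'a" where
  "decode = (\<lambda>(E, F, r, v, W, Y, N, B, \<sigma>, \<omega>). (restore (E - und F) v W Y N B \<sigma> \<omega>, v))"

text \<open>The condition asks for many preimages under \<open>decode\<close> instead of a
  dismantling with these parameters, as this is all that double counting uses.\<close>

definition vertices_with_parameters :: "nat \<Rightarrow> nat \<Rightarrow> nat \<Rightarrow> nat \<Rightarrow> (nat set set \<times> nat) set" where
  "vertices_with_parameters n p a k = {x \<in> no_long_cycle_edges n \<times> {1..n}.
     n ^ p * fact p \<le> card {t \<in> rebuilt n p a k. decode t = x} * (p + 1) ^ p}"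

lemma finite_no_long_cycle_edges: "finite (no_long_cycle_edges n)"
  by (rule finite_subset[of _ "Pow (Pow {1..n})"]) (auto simp: no_long_cycle_edges_def)

section \<open>Double counting of attachments and codes\<close>

lemma card_Sigma_le:
  assumes "finite A" "\<And>x. x \<in> A \<Longrightarrow> finite (B x) \<and> card (B x) \<le> c"
  shows "finite (Sigma A B) \<and> card (Sigma A B) \<le> card A * c"
proof
  show "finite (Sigma A B)" using assms by blast
  have "card (Sigma A B) = (\<Sum>x\<in>A. card (B x))" using assms by (intro card_SigmaI) auto
  also have "\<dots> \<le> (\<Sum>x\<in>A. c)" using assms by (intro sum_mono) auto
  finally show "card (Sigma A B) \<le> card A * c" by simp
qed

lemma card_subsets_le:
  assumes "finite R"
  shows "finite {W. W \<subseteq> R \<and> P W} \<and> card {W. W \<subseteq> R \<and> P W} \<le> 2 ^ card R"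
proof
  show "finite {W. W \<subseteq> R \<and> P W}" using assms by (auto intro: finite_subset[of _ "Pow R"])
  have "card {W. W \<subseteq> R \<and> P W} \<le> card (Pow R)" using assms by (intro card_mono) auto
  then show "card {W. W \<subseteq> R \<and> P W} \<le> 2 ^ card R" using assms by (simp add: card_Pow)
qed

text \<open>The factors are \<open>m\<close> for \<open>v\<close>, \<open>2 ^ m\<close> for each of
  \<open>W\<close>, \<open>Y\<close>, \<open>N\<close> and \<open>B\<close>, \<open>16 ^ m\<close>
  for \<open>\<sigma>\<close>, as a root has at most three later neighbours, and
  \<open>k ^ a\<close> for the hubs of the split neighbours.\<close>

lemma card_codes_le:
  assumes V: "finite V" and E: "\<And>e. e \<in> E \<Longrightarrow> e \<subseteq> V \<and> card e = 2" and nlc: "no_long_cycle E"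
    and R: "R \<subseteq> V" "card R \<le> m"
  shows "finite (codes V E R a k) \<and> card (codes V E R a k) \<le> m * 256 ^ m * k ^ a"
proof -
  have fin: "finite R" using R V finite_subset by blast
  let ?S = "Pi\<^sub>E R (\<lambda>r. Pow (insert r (later_nbrs V E r)))"
  have fl: "finite (later_nbrs V E r)" for r
    using later_nbrs_subset[OF V E nlc] V by (metis finite_subset)
  have S: "finite ?S \<and> card ?S \<le> 16 ^ card R"
  proof
    show "finite ?S" using fin fl by (intro finite_PiE) auto
    have "card (Pow (insert r (later_nbrs V E r))) \<le> 16" if "r \<in> R" for r
    proof -
      have "card (insert r (later_nbrs V E r)) \<le> 4"
        using card_later_nbrs[OF V E nlc, of r] that R fl[of r] by (auto simp: card_insert_if)
      then have "(2::nat) ^ card (insert r (later_nbrs V E r)) \<le> 2 ^ 4" by (intro power_increasing) auto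
      then show ?thesis using fl[of r] by (simp add: card_Pow)
    qed
    then have "(\<Prod>r\<in>R. card (Pow (insert r (later_nbrs V E r)))) \<le> (\<Prod>r\<in>R. 16)"
      by (intro prod_mono) auto
    then show "card ?S \<le> 16 ^ card R" using fin by (simp add: card_PiE)
  qed
  have Om: "finite (Pi\<^sub>E Y (\<lambda>_. W)) \<and> card (Pi\<^sub>E Y (\<lambda>_. W)) \<le> k ^ a"
    if "Y \<subseteq> R" "card Y = a" "W \<subseteq> R" "card W = k" for Y W
  proof -
    have "finite Y" "finite W" using that fin finite_subset by blast+
    then show ?thesis using that by (simp add: card_PiE finite_PiE)
  qed
  have pw: "finite (Pow R) \<and> card (Pow R) \<le> 2 ^ card R" using fin by (simp add: card_Pow)
  let ?c = "card R"
  have "finite (codes V E R a k) \<and>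
      card (codes V E R a k) \<le> ?c * (card {W. W \<subseteq> R \<and> card W = k} * (card {Y. Y \<subseteq> R \<and> card Y = a} *
        (card (Pow R) * (card (Pow R) * (card ?S * k ^ a)))))"
    unfolding codes_def
    by (intro card_Sigma_le)
      (use fin S pw Om card_subsets_le[OF fin, of "\<lambda>W. card W = k"]
        card_subsets_le[OF fin, of "\<lambda>Y. card Y = a"] in auto)
  moreover have "?c * (card {W. W \<subseteq> R \<and> card W = k} * (card {Y. Y \<subseteq> R \<and> card Y = a} *
        (card (Pow R) * (card (Pow R) * (card ?S * k ^ a)))))
      \<le> ?c * (2 ^ ?c * (2 ^ ?c * (2 ^ ?c * (2 ^ ?c * (16 ^ ?c * k ^ a)))))"
    using S pw card_subsets_le[OF fin, of "\<lambda>W. card W = k"] card_subsets_le[OF fin, of "\<lambda>Y. card Y = a"]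
    by (intro mult_le_mono) auto
  moreover have "?c * (2 ^ ?c * (2 ^ ?c * (2 ^ ?c * (2 ^ ?c * (16 ^ ?c * k ^ a))))) = ?c * 256 ^ ?c * k ^ a"
    by (simp add: mult.assoc[symmetric] power_mult_distrib[symmetric])
  moreover have "?c * 256 ^ ?c * k ^ a \<le> m * 256 ^ m * k ^ a"
    using R(2) by (intro mult_le_mono order_refl power_increasing) auto
  ultimately show ?thesis by linarith
qed

text \<open>There are at most \<open>6 * n choose p\<close> sets of arcs, which the factor
  \<open>fact p\<close> turns into \<open>(6 * n) ^ p\<close>, and \<open>n\<close> choices for
  \<open>r\<close>.\<close>

lemma card_rebuilt_le:
  "finite (rebuilt n p a k) \<and> card (rebuilt n p a k) * fact p \<le>
     card (no_long_cycle_edges n) * (6 * n) ^ p * n * ((p + 1) * 256 ^ (p + 1) * k ^ a)"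
proof -
  let ?C = "(p + 1) * 256 ^ (p + 1) * k ^ a"
  have inner: "finite (SIGMA F:{F. F \<subseteq> adj E \<and> card F = p}. SIGMA r:{1..n}.
       codes {1..n} (E - und F) (insert r (snd ` F)) a k) \<and>
     card (SIGMA F:{F. F \<subseteq> adj E \<and> card F = p}. SIGMA r:{1..n}.
       codes {1..n} (E - und F) (insert r (snd ` F)) a k) \<le> (6 * n choose p) * (n * ?C)"
    if E: "E \<in> no_long_cycle_edges n" for E
  proof -
    have ed: "\<And>e. e \<in> E \<Longrightarrow> e \<subseteq> {1..n} \<and> card e = 2" "no_long_cycle E"
      using E by (auto simp: no_long_cycle_edges_def)
    have arcs: "finite (adj E)" "card (adj E) \<le> 6 * n"
      using card_arcs_le[OF finite_atLeastAtMost ed] by auto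
    have F: "finite {F. F \<subseteq> adj E \<and> card F = p}"
      using card_subsets_le[OF arcs(1), of "\<lambda>F. card F = p"] by (rule conjunct1)
    have cF: "card {F. F \<subseteq> adj E \<and> card F = p} \<le> (6 * n choose p)"
      using n_subsets[OF arcs(1), of p] binomial_right_mono[OF arcs(2)] by simp
    have bound: "finite (SIGMA F:{F. F \<subseteq> adj E \<and> card F = p}. SIGMA r:{1..n}.
       codes {1..n} (E - und F) (insert r (snd ` F)) a k) \<and>
     card (SIGMA F:{F. F \<subseteq> adj E \<and> card F = p}. SIGMA r:{1..n}.
       codes {1..n} (E - und F) (insert r (snd ` F)) a k) \<le>
         card {F. F \<subseteq> adj E \<and> card F = p} * (card {1..n} * ?C)"
    proof (intro card_Sigma_le card_codes_le F)
      fix F r assume F: "F \<in> {F. F \<subseteq> adj E \<and> card F = p}" and r: "r \<in> {1..n}"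
      show "e \<subseteq> {1..n} \<and> card e = 2" if "e \<in> E - und F" for e using that ed by blast
      show "no_long_cycle (E - und F)" using ed(2) by (rule no_long_cycle_mono) blast
      have "snd ` F \<subseteq> {1..n}" using F ed(1) by (fastforce simp: adj_def)
      then show "insert r (snd ` F) \<subseteq> {1..n}" using r by blast
      have "finite F" using F arcs(1) finite_subset by blast
      then have "card (snd ` F) \<le> p" using F card_image_le[of F snd] by auto
      then show "card (insert r (snd ` F)) \<le> p + 1"
        using card_insert_le_m1[of "p + 1" "snd ` F" r] by simp
    qed auto
    have n: "card {1..n} = n" by simp
    show ?thesis
      using bound order.trans[OF conjunct2[OF bound] mult_le_mono1[OF cF]] unfolding n by (intro conjI) blast
  qed
  have "finite (rebuilt n p a k) \<and>
      card (rebuilt n p a k) \<le> card (no_long_cycle_edges n) * ((6 * n choose p) * (n * ?C))"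
    unfolding rebuilt_def using inner by (intro card_Sigma_le finite_no_long_cycle_edges) blast
  then have fin: "finite (rebuilt n p a k)" and
    le: "card (rebuilt n p a k) \<le> card (no_long_cycle_edges n) * ((6 * n choose p) * (n * ?C))" by auto
  have "card (rebuilt n p a k) * fact p \<le>
      card (no_long_cycle_edges n) * ((6 * n choose p) * (n * ?C)) * fact p"
    using le by (rule mult_le_mono1)
  also have "\<dots> = card (no_long_cycle_edges n) * ((6 * n choose p) * fact p) * n * ?C" by simp
  also have "\<dots> \<le> card (no_long_cycle_edges n) * (6 * n) ^ p * n * ?C"
    by (intro mult_le_mono binomial_fact_pow) auto
  finally show ?thesis using fin by simp
qed

text \<open>The fibres of \<open>decode\<close> are disjoint, and those in question have at least
  \<open>n ^ p * fact p / (p + 1) ^ p\<close> elements. Here \<open>n ^ p\<close> cancels against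
  the choice of the arcs, so a single factor \<open>n\<close> remains.\<close>

lemma card_vertices_with_parameters_le:
  assumes "n \<ge> 1"
  shows "card (vertices_with_parameters n p a k) * (fact p * fact p) \<le>
    card (no_long_cycle_edges n) * n * (6 ^ p * (p + 1) ^ p * ((p + 1) * 256 ^ (p + 1)) * k ^ a)"
proof -
  let ?X = "vertices_with_parameters n p a k" and ?T = "rebuilt n p a k"
  have finX: "finite ?X"
    unfolding vertices_with_parameters_def using finite_no_long_cycle_edges by auto
  have finT: "finite ?T" using card_rebuilt_le by blast
  have "card ?X * (n ^ p * fact p) = (\<Sum>x\<in>?X. n ^ p * fact p)" by simp
  also have "\<dots> \<le> (\<Sum>x\<in>?X. card {t \<in> ?T. decode t = x} * (p + 1) ^ p)"
    by (intro sum_mono) (auto simp: vertices_with_parameters_def)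
  also have "\<dots> = (\<Sum>x\<in>?X. card {t \<in> ?T. decode t = x}) * (p + 1) ^ p"
    by (simp add: sum_distrib_right)
  also have "(\<Sum>x\<in>?X. card {t \<in> ?T. decode t = x}) = card (\<Union>x\<in>?X. {t \<in> ?T. decode t = x})"
    using finX finT by (subst card_UN_disjoint) auto
  also have "\<dots> \<le> card ?T" using finT by (intro card_mono) auto
  finally have "card ?X * (n ^ p * fact p) \<le> card ?T * (p + 1) ^ p" by simp
  then have "card ?X * (n ^ p * fact p) * fact p \<le> card ?T * (p + 1) ^ p * fact p"
    by (rule mult_le_mono1)
  also have "\<dots> = card ?T * fact p * (p + 1) ^ p" by simp
  also have "\<dots> \<le> card (no_long_cycle_edges n) * (6 * n) ^ p * n * ((p + 1) * 256 ^ (p + 1) * k ^ a) * (p + 1) ^ p"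
    using card_rebuilt_le[of n p a k] by (intro mult_le_mono1) blast
  finally have "n ^ p * (card ?X * (fact p * fact p)) \<le>
     n ^ p * (card (no_long_cycle_edges n) * n * (6 ^ p * (p + 1) ^ p * ((p + 1) * 256 ^ (p + 1)) * k ^ a))"
    by (simp add: power_mult_distrib mult_ac)
  then show ?thesis using assms by simp
qed

text \<open>Every attachment of the dismantled graph gives a preimage of \<open>(E, v)\<close>, and
  different attachments give different ones because \<open>F\<close> is part of the tuple.\<close>

lemma vertex_has_parameters:
  assumes E: "E \<in> no_long_cycle_edges n" and v: "v \<in> {1..n}" and d: "d = card {u. {v, u} \<in> E}"
  shows "\<exists>p a k. p \<le> 2 * d \<and> a + k \<le> p \<and> d \<le> a + k + 3 * (p - a - k) \<and>
    (E, v) \<in> vertices_with_parameters n p a k"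
proof -
  interpret vertex_in_graph "{1..n}" E v
    using E v by unfold_locales (auto simp: no_long_cycle_edges_def)
  have nbrs: "card nbrs = d" by (simp add: nbrs_def d)
  obtain E0 W Y N B \<sigma> \<omega> where
    E0: "\<forall>e\<in>E0. e \<subseteq> {1..n} \<and> card e = 2" "no_long_cycle E0" and
    R: "insert v (W \<union> Y \<union> N) \<subseteq> {1..n}" "B \<subseteq> W \<union> N"
      "card (insert v (W \<union> Y \<union> N)) = Suc (card Y + card W + card N)" and
    sep: "\<forall>x\<in>insert v (W \<union> Y \<union> N). \<forall>y\<in>insert v (W \<union> Y \<union> N). x \<noteq> y \<longrightarrow> (x, y) \<notin> (adj E0)\<^sup>*" and
    restore: "restore E0 v W Y N B \<sigma> \<omega> = E" and
    \<sigma>: "\<forall>r\<in>N. \<sigma> r \<subseteq> insert r (later_nbrs {1..n} E0 r)" and \<omega>: "\<omega> ` Y \<subseteq> W" and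
    cards: "card W \<le> card Y" "card Y + card N \<le> card nbrs" "card nbrs \<le> card Y + card W + 3 * card N"
    using dismantle by metis
  define R where "R = insert v (W \<union> Y \<union> N)"
  define p a k where "p = card Y + card W + card N" and "a = card Y" and "k = card W"
  have "\<exists>r\<in>R. \<exists>\<F>. finite \<F> \<and> card {1..n} ^ p * fact p \<le> card \<F> * (p + 1) ^ p \<and>
    (\<forall>F\<in>\<F>. card F = p \<and> snd ` F = R - {r} \<and> E0 \<inter> und F = {} \<and>
       (\<forall>e\<in>E0 \<union> und F. e \<subseteq> {1..n} \<and> card e = 2) \<and> no_long_cycle (E0 \<union> und F))"
  proof (rule exists_many_attachments)
    show "e \<subseteq> {1..n} \<and> card e = 2" if "e \<in> E0" for e using E0(1) that by blast
    show "R \<subseteq> {1..n}" "card R = Suc p" using R(1,3) unfolding R_def p_def by auto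
    show "(x, y) \<notin> (adj E0)\<^sup>*" if "x \<in> R" "y \<in> R" "x \<noteq> y" for x y
      using sep[folded R_def, rule_format, OF that] .
  qed (use E0 in simp_all)
  then obtain r \<F> where r: "r \<in> R" and \<F>: "finite \<F>" "card {1..n} ^ p * fact p \<le> card \<F> * (p + 1) ^ p"
    and F': "\<forall>F\<in>\<F>. card F = p \<and> snd ` F = R - {r} \<and> E0 \<inter> und F = {} \<and>
       (\<forall>e\<in>E0 \<union> und F. e \<subseteq> {1..n} \<and> card e = 2) \<and> no_long_cycle (E0 \<union> und F)"
    by (elim bexE exE conjE) (rule that; assumption)
  note F = F'[rule_format]
  \<comment> \<open>\<open>codes\<close> asks for extensional functions, and for values of
    \<open>\<sigma>\<close> on all of \<open>R\<close>. The default \<open>{}\<close> outside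
    \<open>N\<close> is not read by \<open>restore\<close>.\<close>
  define \<sigma>' where "\<sigma>' = restrict (\<lambda>r. if r \<in> N then \<sigma> r else {}) R"
  define \<omega>' where "\<omega>' = restrict \<omega> Y"
  have restore': "restore E0 v W Y N B \<sigma>' \<omega>' = E"
  proof -
    have "\<sigma>' ` (N \<inter> B) = \<sigma> ` (N \<inter> B)" "\<And>r. r \<in> N \<Longrightarrow> \<sigma>' r = \<sigma> r" "\<And>y. y \<in> Y \<Longrightarrow> \<omega>' y = \<omega> y"
      by (auto simp: \<sigma>'_def \<omega>'_def R_def)
    then have "restore E0 v W Y N B \<sigma>' \<omega>' = restore E0 v W Y N B \<sigma> \<omega>"
      unfolding restore_def by (smt (verit, best) Collect_cong)
    then show ?thesis using restore by simp
  qed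
  let ?t = "\<lambda>F. (E0 \<union> und F, F, r, v, W, Y, N, B, \<sigma>', \<omega>')"
  have sub: "?t ` \<F> \<subseteq> {t \<in> rebuilt n p a k. decode t = (E, v)}"
  proof clarify
    fix F assume F': "F \<in> \<F>"
    have diff: "(E0 \<union> und F) - und F = E0" using F[OF F'] by blast
    have ins: "insert r (snd ` F) = R" using F[OF F'] r by blast
    have "E0 \<union> und F \<in> no_long_cycle_edges n" using F[OF F'] by (simp add: no_long_cycle_edges_def)
    moreover have "F \<subseteq> adj (E0 \<union> und F)" by (force simp: adj_def und_def)
    moreover have "r \<in> {1..n}" using r R(1) by (auto simp: R_def)
    moreover have "(v, W, Y, N, B, \<sigma>', \<omega>') \<in> codes {1..n} E0 R a k"
      using R(2) \<sigma> \<omega> unfolding codes_def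
      by (auto simp: R_def a_def k_def \<sigma>'_def \<omega>'_def)
    ultimately have "?t F \<in> rebuilt n p a k"
      unfolding rebuilt_def using F[OF F'] by (simp add: diff insert_absorb r)
    moreover have "decode (?t F) = (E, v)" using restore' by (simp add: decode_def diff)
    ultimately show "?t F \<in> rebuilt n p a k \<and> decode (?t F) = (E, v)" by blast
  qed
  have "finite {t \<in> rebuilt n p a k. decode t = (E, v)}" using card_rebuilt_le by simp
  from card_mono[OF this sub] have "card \<F> \<le> card {t \<in> rebuilt n p a k. decode t = (E, v)}"
    by (subst (asm) card_image) (auto intro: inj_onI)
  then have "card \<F> * (p + 1) ^ p \<le> card {t \<in> rebuilt n p a k. decode t = (E, v)} * (p + 1) ^ p"
    by (rule mult_le_mono1)
  then have "(E, v) \<in> vertices_with_parameters n p a k"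
    using order.trans[OF \<F>(2)] E v unfolding vertices_with_parameters_def by simp
  \<comment> \<open>\<open>p - a - k\<close> is \<open>card N\<close>. The first bound holds because
    there are at most as many hubs as split neighbours.\<close>
  moreover have "p \<le> 2 * d" "a + k \<le> p" "d \<le> a + k + 3 * (p - a - k)"
    using cards nbrs by (auto simp: p_def a_def k_def)
  ultimately show ?thesis by blast
qed

section \<open>Asymptotics\<close>

text \<open>\<open>p ^ p / fact p\<close> is one term of the series for \<open>exp p\<close>, and
  \<open>exp 1 \<le> 3\<close>.\<close>

lemma self_power_le_fact: "real p ^ p \<le> 3 ^ p * fact p"
proof -
  have "(\<Sum>i\<in>{p}. inverse (fact i) * real p ^ i) \<le> (\<Sum>i. inverse (fact i) * real p ^ i)"
    using summable_exp[of "real p"] by (intro sum_le_suminf) auto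
  also have "\<dots> = exp (real p)" by (simp add: exp_def)
  also have "\<dots> = exp 1 ^ p" by (simp add: exp_of_nat_mult[symmetric])
  also have "\<dots> \<le> 3 ^ p" by (intro power_mono exp_le) auto
  finally show ?thesis by (simp add: field_simps)
qed

text \<open>The extremal value of \<open>k\<close> is of order \<open>p / ln p\<close>, as for set partitions; the inequality
  \<open>x \<le> exp x\<close> at \<open>x = k (ln p - ln (ln p)) / p\<close> is sharp there up to exponential factors.\<close>
lemma power_le_partition_bound:
  assumes p: "p \<ge> 3" and ak: "a + k + s = p"
  shows "real k ^ a * ln (real p) ^ (a + k + 3 * s) \<le> 27 ^ p * real p ^ p"
proof -
  define L where "L = ln (real p)"
  define l where "l = L - ln L"
  have "exp 1 \<le> real p" using exp_le p by linarith
  then have L1: "1 \<le> L" unfolding L_def using p by (subst ln_ge_iff) auto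
  have expL: "exp L = real p" using p by (simp add: L_def)
  have "ln L = ln (L / 2) + ln 2" using L1 by (simp add: ln_div)
  also have "\<dots> \<le> (L / 2 - 1) + 1" using L1 ln_le_minus_one[of "L / 2"] ln_2_less_1 by linarith
  finally have l: "L / 2 \<le> l" by (simp add: l_def)
  have expl: "exp l = real p / L" using L1 by (simp add: l_def exp_diff expL)
  have "real k * l / real p \<le> exp (real k * l / real p)"
    using exp_ge_add_one_self[of "real k * l / real p"] by linarith
  then have "(real k * l / real p) ^ a \<le> exp (real k * l / real p) ^ a"
    using l L1 by (intro power_mono) auto
  also have "\<dots> = exp (real a * (real k * l / real p))" by (simp only: exp_of_nat_mult)
  \<comment> \<open>\<open>a \<le> p\<close> reduces the exponent to \<open>k * l\<close>, and
    \<open>exp l = p / L\<close> then supplies the factor \<open>L ^ k\<close> for the hubs.\<close>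
  also have "\<dots> \<le> exp (real k * l)"
  proof -
    have "real a * (real k * l) \<le> real p * (real k * l)"
      using ak l L1 by (intro mult_right_mono) auto
    then show ?thesis using p by (simp add: field_simps)
  qed
  also have "\<dots> = (real p / L) ^ k" by (simp add: exp_of_nat_mult expl)
  finally have "real k ^ a * l ^ a * L ^ k \<le> real p ^ (a + k)"
    using p L1 by (simp add: power_divide power_mult_distrib power_add field_simps)
  moreover have "real k ^ a * (L / 2) ^ a * L ^ k \<le> real k ^ a * l ^ a * L ^ k"
    using l L1 by (intro mult_right_mono mult_left_mono power_mono) auto
  ultimately have "real k ^ a * (L / 2) ^ a * L ^ k \<le> real p ^ (a + k)" by linarith
  then have A: "real k ^ a * L ^ (a + k) \<le> 2 ^ a * real p ^ (a + k)"
    by (simp add: power_divide power_add field_simps)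
  \<comment> \<open>A small set stands for up to three neighbours, so its single factor
    \<open>p\<close> has to absorb \<open>L ^ 3\<close>.\<close>
  have "L / 3 \<le> exp (L / 3)" using exp_ge_add_one_self[of "L / 3"] by linarith
  then have "(L / 3) ^ 3 \<le> exp (L / 3) ^ 3" using L1 by (intro power_mono) auto
  also have "\<dots> = real p" by (simp add: exp_of_nat_mult[symmetric] expL)
  finally have "L ^ 3 \<le> 27 * real p" by (simp add: power_divide)
  then have "(L ^ 3) ^ s \<le> (27 * real p) ^ s" using L1 by (intro power_mono) auto
  then have "(real k ^ a * L ^ (a + k)) * (L ^ 3) ^ s \<le> (2 ^ a * real p ^ (a + k)) * (27 * real p) ^ s"
    by (rule mult_mono[OF A]) (use L1 in auto)
  also have "\<dots> = 2 ^ a * 27 ^ s * (real p ^ (a + k) * real p ^ s)"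
    by (simp only: power_mult_distrib mult_ac)
  also have "real p ^ (a + k) * real p ^ s = real p ^ p"
    by (simp only: ak flip: power_add)
  also have "(2::real) ^ a * 27 ^ s \<le> 27 ^ a * 27 ^ s"
    by (intro mult_right_mono power_mono) auto
  also have "(27::real) ^ a * 27 ^ s \<le> 27 ^ p"
    using ak by (simp flip: power_add)
  finally show ?thesis
    unfolding L_def[symmetric] by (simp add: power_add power_mult mult.assoc mult_right_mono)
qed

text \<open>The two factorials, from the number of attachments and the choice of the arcs, absorb
  \<open>(p + 1) ^ p\<close> and \<open>k ^ a\<close>, the latter with a gain of \<open>ln p\<close>
  per neighbour. The exponential factors multiply to \<open>746496 = 6 * 3 * 2 * 256 * 81\<close>,
  cubed because \<open>p + 1 \<le> 3 * d\<close>. From \<open>d \<ge> 9\<close> follow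
  \<open>p \<ge> 3\<close> and \<open>ln (d / 3) \<ge> 1\<close>.\<close>

lemma card_vertices_with_parameters_real_le:
  assumes n: "n \<ge> 1" and d: "d \<ge> 9" and pak: "p \<le> 2 * d" "a + k \<le> p" "d \<le> a + k + 3 * (p - a - k)"
  shows "real (card (vertices_with_parameters n p a k)) \<le>
     card (no_long_cycle_edges n) * n * (746496 ^ 3 / ln (real d / 3)) ^ d"
proof -
  let ?X = "real (card (vertices_with_parameters n p a k))"
  let ?G = "real (card (no_long_cycle_edges n)) * real n"
  define m where "m = a + k + 3 * (p - a - k)"
  define L where "L = ln (real p)"
  have p: "3 \<le> p" "d \<le> 3 * p" using pak d by linarith+
  have "exp 1 \<le> real d / 3" using exp_le d by linarith
  then have l1: "1 \<le> ln (real d / 3)" using d by (subst ln_ge_iff) auto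
  moreover have lL: "ln (real d / 3) \<le> L" unfolding L_def using p d by (subst ln_le_cancel_iff) auto
  ultimately have L1: "1 \<le> L" by linarith
  have B1: "real (p + 1) ^ p \<le> 3 ^ (p + 1) * fact p"
  proof -
    have "real (p + 1) * real (p + 1) ^ p \<le> real (p + 1) * (3 ^ (p + 1) * fact p)"
      using self_power_le_fact[of "p + 1"] by (simp add: mult_ac)
    then show ?thesis by (subst (asm) mult_le_cancel_left_pos) auto
  qed
  have B2: "real k ^ a * L ^ m \<le> 81 ^ p * fact p"
  proof -
    have "real k ^ a * L ^ m \<le> 27 ^ p * real p ^ p"
      unfolding L_def m_def using p pak by (intro power_le_partition_bound) auto
    also have "\<dots> \<le> 27 ^ p * (3 ^ p * fact p)" using self_power_le_fact by (intro mult_left_mono) auto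
    also have "\<dots> = 81 ^ p * fact p" by (simp flip: power_mult_distrib mult.assoc)
    finally show ?thesis .
  qed
  have B3: "real (p + 1) \<le> 2 ^ (p + 1)"
    using of_nat_less_two_power[of "p + 1", where 'a = real] by simp
  have "?X * (fact p * fact p) \<le>
      ?G * (6 ^ p * real (p + 1) ^ p * (real (p + 1) * 256 ^ (p + 1)) * real k ^ a)"
    using card_vertices_with_parameters_le[OF n, of p a k, folded of_nat_le_iff[where 'a = real]]
    by (simp only: of_nat_mult of_nat_power of_nat_fact of_nat_numeral mult.assoc)
  then have "?X * (fact p * fact p) * L ^ m \<le>
      ?G * (6 ^ p * real (p + 1) ^ p * (real (p + 1) * 256 ^ (p + 1)) * real k ^ a) * L ^ m"
    using L1 by (intro mult_right_mono) auto
  also have "\<dots> = ?G * (6 ^ p * real (p + 1) ^ p * (real (p + 1) * 256 ^ (p + 1)) * (real k ^ a * L ^ m))"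
    by simp
  also have "\<dots> \<le> ?G * (6 ^ (p + 1) * (3 ^ (p + 1) * fact p) * (2 ^ (p + 1) * 256 ^ (p + 1)) * (81 ^ (p + 1) * fact p))"
  proof -
    have h1: "(6::real) ^ p * real (p + 1) ^ p \<le> 6 ^ (p + 1) * (3 ^ (p + 1) * fact p)"
      by (rule mult_mono[OF _ B1]) auto
    have h2: "real (p + 1) * 256 ^ (p + 1) \<le> 2 ^ (p + 1) * 256 ^ (p + 1)"
      by (rule mult_right_mono[OF B3]) simp
    have "(81::real) ^ p * fact p \<le> 81 ^ (p + 1) * fact p" by (rule mult_right_mono) auto
    then have h3: "real k ^ a * L ^ m \<le> 81 ^ (p + 1) * fact p" using B2 by linarith
    show ?thesis
      by (rule mult_left_mono[OF mult_mono[OF mult_mono[OF h1 h2] h3]]) (use L1 in auto)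
  qed
  also have "\<dots> = ?G * 746496 ^ (p + 1) * (fact p * fact p)"
  proof -
    have "(746496::real) ^ (p + 1) = 6 ^ (p + 1) * 3 ^ (p + 1) * 2 ^ (p + 1) * 256 ^ (p + 1) * 81 ^ (p + 1)"
      by (simp flip: power_mult_distrib)
    then show ?thesis by (simp add: mult_ac)
  qed
  finally have "(?X * L ^ m) * (fact p * fact p) \<le> (?G * 746496 ^ (p + 1)) * (fact p * fact p)"
    by (simp add: mult_ac)
  then have XL: "?X * L ^ m \<le> ?G * 746496 ^ (p + 1)" by simp
  have "ln (real d / 3) ^ d \<le> L ^ d" using l1 lL by (intro power_mono) auto
  also have "\<dots> \<le> L ^ m" using L1 pak(3) by (intro power_increasing) (auto simp: m_def)
  finally have "?X * ln (real d / 3) ^ d \<le> ?X * L ^ m" by (intro mult_left_mono) auto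
  also note XL
  also have "?G * 746496 ^ (p + 1) \<le> ?G * 746496 ^ (3 * d)"
    using pak d by (intro mult_left_mono power_increasing) auto
  also have "(746496::real) ^ (3 * d) = (746496 ^ 3) ^ d" by (rule power_mult)
  finally have "?X \<le> ?G * (746496 ^ 3 / ln (real d / 3)) ^ d"
    using l1 by (simp add: power_divide field_simps)
  then show ?thesis by simp
qed

definition vertices_of_degree :: "nat \<Rightarrow> nat \<Rightarrow> (nat set set \<times> nat) set" where
  "vertices_of_degree n d = {(E, v). E \<in> no_long_cycle_edges n \<and> v \<in> {1..n} \<and> card {u. {v, u} \<in> E} = d}"

lemma finite_vertices_of_degree: "finite (vertices_of_degree n d)"
  by (rule finite_subset[of _ "no_long_cycle_edges n \<times> {1..n}"])
    (auto simp: vertices_of_degree_def finite_no_long_cycle_edges)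

text \<open>At most \<open>(2 * d + 1) ^ 3 \<le> 27 ^ d\<close> triples \<open>(p, a, k)\<close>
  occur, whence the additional factor 27.\<close>

lemma card_vertices_of_degree_le:
  assumes n: "n \<ge> 1" and d: "d \<ge> 9"
  shows "real (card (vertices_of_degree n d)) \<le>
     card (no_long_cycle_edges n) * n * (27 * 746496 ^ 3 / ln (real d / 3)) ^ d"
proof -
  let ?I = "{(p, a, k). p \<le> 2 * d \<and> a + k \<le> p \<and> d \<le> a + k + 3 * (p - a - k)}"
  let ?X = "\<lambda>(p, a, k). vertices_with_parameters n p a k"
  let ?b = "card (no_long_cycle_edges n) * n * (746496 ^ 3 / ln (real d / 3)) ^ d"
  have sub: "?I \<subseteq> {..2 * d} \<times> {..2 * d} \<times> {..2 * d}" by auto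
  have fin: "finite ?I" by (rule finite_subset[OF sub]) simp
  have "exp 1 \<le> real d / 3" using exp_le d by linarith
  then have l1: "1 \<le> ln (real d / 3)" using d by (subst ln_ge_iff) auto
  have finX: "finite (?X x)" for x
    by (cases x) (auto simp: vertices_with_parameters_def finite_no_long_cycle_edges)
  have "2 * d + 1 \<le> 3 ^ d" by (induction d) auto
  have "card ?I \<le> card ({..2 * d} \<times> {..2 * d} \<times> {..2 * d})"
    using sub by (intro card_mono) auto
  also have "\<dots> = (2 * d + 1) ^ 3" by (simp add: card_cartesian_product power3_eq_cube)
  also have "\<dots> \<le> (3 ^ d) ^ 3" using \<open>2 * d + 1 \<le> 3 ^ d\<close> by (rule power_mono) simp
  also have "\<dots> = 27 ^ d" by (simp add: power_mult[symmetric] mult.commute[of d]) (simp add: power_mult)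
  finally have cI: "card ?I \<le> 27 ^ d" .
  have "vertices_of_degree n d \<subseteq> (\<Union>x\<in>?I. ?X x)"
  proof clarify
    fix E v assume "(E, v) \<in> vertices_of_degree n d"
    then obtain p a k where "p \<le> 2 * d" "a + k \<le> p" "d \<le> a + k + 3 * (p - a - k)"
        "(E, v) \<in> vertices_with_parameters n p a k"
      using vertex_has_parameters[of E n v d] by (auto simp: vertices_of_degree_def)
    then show "(E, v) \<in> (\<Union>x\<in>?I. ?X x)" by (intro UN_I[of "(p, a, k)"]) auto
  qed
  then have "card (vertices_of_degree n d) \<le> card (\<Union>x\<in>?I. ?X x)"
    using fin finX by (intro card_mono) blast+
  also have "\<dots> \<le> (\<Sum>x\<in>?I. card (?X x))" using fin by (rule card_UN_le)
  finally have "real (card (vertices_of_degree n d)) \<le> real (\<Sum>x\<in>?I. card (?X x))"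
    by (rule of_nat_mono)
  also have "\<dots> = (\<Sum>x\<in>?I. real (card (?X x)))" by (rule of_nat_sum)
  also have "\<dots> \<le> (\<Sum>x\<in>?I. ?b)"
    using card_vertices_with_parameters_real_le[OF n d] by (intro sum_mono) auto
  also have "\<dots> = real (card ?I) * ?b" by simp
  also have "\<dots> \<le> 27 ^ d * ?b"
    using of_nat_mono[OF cI, where 'a = real] l1 by (intro mult_right_mono) auto
  also have "\<dots> = card (no_long_cycle_edges n) * n * (27 * 746496 ^ 3 / ln (real d / 3)) ^ d"
  proof -
    have "(27::real) ^ d * (746496 ^ 3 / ln (real d / 3)) ^ d = (27 * 746496 ^ 3 / ln (real d / 3)) ^ d"
      by (simp only: power_mult_distrib[symmetric] times_divide_eq_right)
    then show ?thesis by (simp only: mult.left_commute)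
  qed
  finally show ?thesis .
qed

section \<open>From vertices of given degree to the random graph\<close>

lemma gdegree_eq_card_nbrs:
  assumes "simple_graph G"
  shows "gdegree G v = card {u. {v, u} \<in> gedges G}"
proof -
  have "bij_betw (\<lambda>u. {v, u}) {u. {v, u} \<in> gedges G} {e \<in> gedges G. v \<in> e}"
  proof (rule bij_betw_imageI)
    show "inj_on (\<lambda>u. {v, u}) {u. {v, u} \<in> gedges G}" by (auto simp: inj_on_def doubleton_eq_iff)
    have "e \<in> (\<lambda>u. {v, u}) ` {u. {v, u} \<in> gedges G}" if e: "e \<in> gedges G" "v \<in> e" for e
    proof -
      obtain a b where "e = {a, b}" using assms e by (meson card_2_iff simple_graph_def)
      then obtain u where "e = {v, u}" using e by blast
      then show ?thesis using e by blast
    qed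
    then show "(\<lambda>u. {v, u}) ` {u. {v, u} \<in> gedges G} = {e \<in> gedges G. v \<in> e}" by blast
  qed
  then show ?thesis by (simp add: gdegree_def bij_betw_same_card)
qed

text \<open>Union bound over the degrees from \<open>m\<close>, which is \<open>D\<close> rounded
  up, to \<open>n\<close>. Since \<open>q \<le> 1 / 2\<close>, the geometric sum is at most twice
  its first term.\<close>

lemma prob_large_max_degree_le:
  fixes D :: real and n :: nat
  defines "q \<equiv> 27 * 746496 ^ 3 / ln (D / 3)"
  assumes n: "n \<ge> 1" and D: "D \<ge> 9" and q: "q \<le> 1 / 2"
  shows "measure_pmf.prob (random_graph (Ex_minor (cycle_graph 5)) n) {G. D < real (max_degree G)}
     \<le> 2 * real n * q powr D"
proof -
  let ?S = "graphs_of_size (Ex_minor (cycle_graph 5)) n" and ?E = "no_long_cycle_edges n"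
  let ?bad = "?S \<inter> {G. D < real (max_degree G)}"
  define m where "m = nat \<lceil>D\<rceil>"
  have m: "D \<le> real m" "9 \<le> m" using D unfolding m_def by linarith+
  have "exp 1 \<le> D / 3" using exp_le D by linarith
  then have "1 \<le> ln (D / 3)" using D by (subst ln_ge_iff) auto
  then have q0: "0 < q" unfolding q_def by simp
  have finS: "finite ?S" by (rule finite_graphs_of_size_Ex)
  have cS: "card ?S = card ?E" unfolding graphs_of_size_Ex_C5 by (simp add: card_image inj_on_def)
  have cS0: "card ?S > 0" using finS graphs_of_size_Ex_C5_nonempty by (simp add: card_gt_0_iff)
  have "(\<Sum>d=m..n. q ^ d) \<le> 2 * q ^ m"
  proof (cases "n < m")
    case False
    then have "(\<Sum>d=m..n. q ^ d) = (q ^ m - q ^ Suc n) / (1 - q)" using q by (simp add: sum_gp)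
    also have "\<dots> \<le> q ^ m / (1 / 2)" using q q0 by (intro frac_le) auto
    finally show ?thesis by simp
  qed (use q0 in simp)
  also have "q ^ m \<le> q powr D"
  proof -
    have "q ^ m = q powr real m" using q0 by (simp add: powr_realpow)
    also have "\<dots> \<le> q powr D" using q0 q m by (intro powr_mono') auto
    finally show ?thesis .
  qed
  finally have geom: "(\<Sum>d=m..n. q ^ d) \<le> 2 * q powr D" by simp
  have "?bad \<subseteq> (\<Union>d\<in>{m..n}. (\<lambda>(E, v). ({1..n}, E)) ` vertices_of_degree n d)"
  proof
    fix G assume G: "G \<in> ?bad"
    then have sg: "simple_graph G" "gverts G = {1..n}" and nl: "gedges G \<in> ?E"
      unfolding graphs_of_size_Ex_C5 by (fastforce simp: simple_graph_def no_long_cycle_edges_def)+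
    have "max_degree G \<in> gdegree G ` gverts G"
      unfolding max_degree_def using sg n by (intro Max_in) auto
    then obtain v where v: "v \<in> {1..n}" "max_degree G = gdegree G v" using sg by auto
    define d where "d = gdegree G v"
    have nb: "d = card {u. {v, u} \<in> gedges G}" using sg by (simp add: d_def gdegree_eq_card_nbrs)
    have "{u. {v, u} \<in> gedges G} \<subseteq> {1..n}" using sg unfolding simple_graph_def by auto
    then have "d \<le> n" unfolding nb using card_mono[of "{1..n}"] by fastforce
    moreover have "D < real d" using G v by (simp add: d_def)
    then have "m \<le> d" unfolding m_def by linarith
    moreover have "(gedges G, v) \<in> vertices_of_degree n d"
      using nl v nb by (simp add: vertices_of_degree_def)
    moreover have "G = (\<lambda>(E, v). ({1..n}, E)) (gedges G, v)" using sg by (simp add: prod_eq_iff)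
    ultimately show "G \<in> (\<Union>d\<in>{m..n}. (\<lambda>(E, v). ({1..n}, E)) ` vertices_of_degree n d)"
      by (intro UN_I[of d] image_eqI[of _ _ "(gedges G, v)"]) auto
  qed
  then have "card ?bad \<le> card (\<Union>d\<in>{m..n}. (\<lambda>(E, v). ({1..n}, E)) ` vertices_of_degree n d)"
    using finite_vertices_of_degree by (intro card_mono) auto
  also have "\<dots> \<le> (\<Sum>d=m..n. card ((\<lambda>(E, v). ({1..n}, E)) ` vertices_of_degree n d))"
    by (rule card_UN_le) simp
  also have "\<dots> \<le> (\<Sum>d=m..n. card (vertices_of_degree n d))"
    using finite_vertices_of_degree by (intro sum_mono card_image_le)
  finally have "real (card ?bad) \<le> real (\<Sum>d=m..n. card (vertices_of_degree n d))"
    by (rule of_nat_mono)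
  also have "\<dots> = (\<Sum>d=m..n. real (card (vertices_of_degree n d)))" by (rule of_nat_sum)
  also have "\<dots> \<le> (\<Sum>d=m..n. real (card ?E) * n * q ^ d)"
  proof (rule sum_mono)
    fix d assume d: "d \<in> {m..n}"
    then have d': "9 \<le> d" "D \<le> real d" using m by auto
    have "ln (D / 3) \<le> ln (real d / 3)" using D d' by (subst ln_le_cancel_iff) auto
    then have "27 * 746496 ^ 3 / ln (real d / 3) \<le> q"
      unfolding q_def using \<open>1 \<le> ln (D / 3)\<close> by (intro divide_left_mono) auto
    then have "(27 * 746496 ^ 3 / ln (real d / 3)) ^ d \<le> q ^ d"
      using \<open>1 \<le> ln (D / 3)\<close> \<open>ln (D / 3) \<le> ln (real d / 3)\<close> by (intro power_mono) auto
    then have "real (card ?E) * n * (27 * 746496 ^ 3 / ln (real d / 3)) ^ d \<le> real (card ?E) * n * q ^ d"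
      by (intro mult_left_mono) auto
    then show "real (card (vertices_of_degree n d)) \<le> real (card ?E) * n * q ^ d"
      using card_vertices_of_degree_le[OF n d'(1), unfolded of_nat_mult] by linarith
  qed
  also have "\<dots> = real (card ?E) * n * (\<Sum>d=m..n. q ^ d)" by (simp add: sum_distrib_left)
  also have "\<dots> \<le> real (card ?E) * n * (2 * q powr D)" by (rule mult_left_mono[OF geom]) simp
  finally have "real (card ?bad) \<le> real (card ?S) * (2 * real n * q powr D)"
    by (simp add: cS mult_ac)
  then have "real (card ?bad) / real (card ?S) \<le> 2 * real n * q powr D"
    using cS0 by (simp add: divide_le_eq mult_ac)
  then show ?thesis
    unfolding random_graph_def
    using measure_pmf_of_set[OF graphs_of_size_Ex_C5_nonempty finS, of "{G. D < real (max_degree G)}"]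
    by simp
qed

text \<open>For large \<open>n\<close> the expression is \<open>2 * exp ((1 + g n) * ln n)\<close>.
  As \<open>ln (ln D)\<close> is asymptotic to \<open>ln (ln (ln n))\<close>, the factor
  \<open>1 + g n\<close> tends to \<open>- \<epsilon>\<close>.\<close>

lemma degree_tail_tendsto_0:
  fixes \<epsilon> C :: real
  assumes "\<epsilon> > 0" "C > 0"
  shows "(\<lambda>n. 2 * real n * (C / ln ((1 + \<epsilon>) * (ln (real n) / ln (ln (ln (real n)))) / 3)) powr
      ((1 + \<epsilon>) * (ln (real n) / ln (ln (ln (real n)))))) \<longlonglongrightarrow> 0"
proof -
  define D where "D x = (1 + \<epsilon>) * (ln x / ln (ln (ln x)))" for x :: real
  define g where "g x = (1 + \<epsilon>) * (ln C - ln (ln (D x / 3))) / ln (ln (ln x))" for x :: real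
  have "(g \<longlongrightarrow> - (1 + \<epsilon>)) at_top" unfolding g_def D_def using assms by real_asymp
  then have "((\<lambda>x. 1 + g x) \<longlongrightarrow> 1 + - (1 + \<epsilon>)) at_top" by (intro tendsto_intros)
  then have "filterlim (\<lambda>x. (1 + g x) * ln x) at_bot at_top"
    using assms ln_at_top by (intro filterlim_tendsto_neg_mult_at_bot) auto
  then have "((\<lambda>x. 2 * exp ((1 + g x) * ln x)) \<longlongrightarrow> 2 * 0) at_top"
    by (intro tendsto_mult tendsto_const filterlim_compose[OF exp_at_bot])
  moreover have "eventually (\<lambda>x. 0 < ln (D x / 3)) at_top" unfolding D_def using assms by real_asymp
  then have "eventually (\<lambda>x. 2 * exp ((1 + g x) * ln x) = 2 * x * (C / ln (D x / 3)) powr D x) at_top"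
    using eventually_gt_at_top[of 0]
  proof eventually_elim
    case (elim x)
    have "(C / ln (D x / 3)) powr D x = exp (D x * (ln C - ln (ln (D x / 3))))"
      using elim assms by (simp add: powr_def ln_div)
    moreover have "D x * (ln C - ln (ln (D x / 3))) = g x * ln x" by (simp add: g_def D_def)
    ultimately show ?case using elim by (simp add: distrib_right exp_add)
  qed
  ultimately have "((\<lambda>x. 2 * x * (C / ln (D x / 3)) powr D x) \<longlongrightarrow> 0) at_top"
    by (simp add: tendsto_cong)
  then show ?thesis
    unfolding D_def by (rule filterlim_compose[OF _ filterlim_real_sequentially])
qed

theorem theorem11:
  fixes \<epsilon> :: real
  assumes "\<epsilon> > 0"
  shows "(\<lambda>n. measure_pmf.prob (random_graph (Ex_minor (cycle_graph 5)) n)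
            {G. real (max_degree G) \<le> (1 + \<epsilon>) * (ln (real n) / ln (ln (ln (real n))))})
         \<longlonglongrightarrow> 1"
proof -
  define D where "D n = (1 + \<epsilon>) * (ln (real n) / ln (ln (ln (real n))))" for n :: nat
  let ?P = "\<lambda>n. measure_pmf.prob (random_graph (Ex_minor (cycle_graph 5)) n)"
  let ?C = "27 * 746496 ^ 3 :: real"
  \<comment> \<open>Since \<open>D n\<close> tends to infinity, the hypotheses
    \<open>D \<ge> 9\<close> and \<open>q \<le> 1 / 2\<close> of
    \<open>prob_large_max_degree_le\<close> hold for all large \<open>n\<close>.\<close>
  have D1: "filterlim D at_top sequentially" unfolding D_def using assms by real_asymp
  then have "eventually (\<lambda>n. D n \<ge> 9) sequentially" by (simp add: filterlim_at_top)
  moreover have "((\<lambda>x::real. ?C / ln (x / 3)) \<longlongrightarrow> 0) at_top" by real_asymp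
  then have "((\<lambda>n. ?C / ln (D n / 3)) \<longlongrightarrow> 0) sequentially" using D1 by (rule filterlim_compose)
  then have "eventually (\<lambda>n. ?C / ln (D n / 3) < 1 / 2) sequentially"
    by (rule order_tendstoD) simp
  ultimately have upper: "eventually (\<lambda>n. ?P n {G. D n < real (max_degree G)}
      \<le> 2 * real n * (?C / ln (D n / 3)) powr D n) sequentially"
    using eventually_ge_at_top[of 1]
    by eventually_elim (rule prob_large_max_degree_le; simp)
  have lim: "(\<lambda>n. 2 * real n * (?C / ln (D n / 3)) powr D n) \<longlonglongrightarrow> 0"
    unfolding D_def by (rule degree_tail_tendsto_0[OF assms]) simp
  have "(\<lambda>n. ?P n {G. D n < real (max_degree G)}) \<longlonglongrightarrow> 0"
    by (rule tendsto_sandwich[OF _ upper tendsto_const lim]) simp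
  then have "(\<lambda>n. 1 - ?P n {G. D n < real (max_degree G)}) \<longlonglongrightarrow> 1 - 0"
    by (intro tendsto_intros)
  moreover have "1 - ?P n {G. D n < real (max_degree G)} = ?P n {G. real (max_degree G) \<le> D n}" for n
  proof -
    have "{G :: nat ugraph. real (max_degree G) \<le> D n} = UNIV - {G. D n < real (max_degree G)}" by auto
    then show ?thesis by (simp add: measure_pmf.prob_compl[of "{G. D n < real (max_degree G)}", simplified])
  qed
  ultimately show ?thesis by (simp add: D_def)
qed

end
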